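(* Let $A,B,C$ be finite-dimensional complex vector spaces and let $X=Seg(\mathbb P A\times\mathbb P B\times\mathbb P C)\subset\mathbb P(A\otimes B\otimes C)$ be a triple Segre product. Then the ideal of the secant variety $\sigma_2(X)$ is generated by cubics.
   Context: Work over $\mathbb C$. The Segre variety is the set of classes of decomposable tensors $a\otimes b\otimes c$. $\sigma_2(X)$ is the Zariski closure of the union of the lines spanned by pairs of points of $X$. The ideal of a projective variety $Z\subset\mathbb P V$ is the homogeneous ideal in $S^\bullet V^*$ of all polynomials vanishing on $Z$ (it may be zero, in which case the assertion is vacuous). *)

theory Defs
  imports Complex_Main "HOL-Algebra.Ideal"
begin

text \<open>
  A complex vector space is an additive group type \<open>'v\<close> with a scalar multiplication
  \<open>s :: complex \<Rightarrow> 'v \<Rightarrow> 'v\<close>, in the style of the locale \<open>vector_space\<close>; the scalar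
  multiplication of the one-dimensional space of scalars is \<open>(*)\<close>.
\<close>

subsection \<open>Tensor products\<close>

definition trilinear ::
  "(complex \<Rightarrow> 'a \<Rightarrow> 'a) \<Rightarrow> (complex \<Rightarrow> 'b \<Rightarrow> 'b) \<Rightarrow> (complex \<Rightarrow> 'c \<Rightarrow> 'c) \<Rightarrow> (complex \<Rightarrow> 'v \<Rightarrow> 'v)
    \<Rightarrow> ('a::ab_group_add \<Rightarrow> 'b::ab_group_add \<Rightarrow> 'c::ab_group_add \<Rightarrow> 'v::ab_group_add) \<Rightarrow> bool"
  where "trilinear sA sB sC sV f \<longleftrightarrow>
    (\<forall>b c. Vector_Spaces.linear sA sV (\<lambda>a. f a b c)) \<and>
    (\<forall>a c. Vector_Spaces.linear sB sV (\<lambda>b. f a b c)) \<and>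
    (\<forall>a b. Vector_Spaces.linear sC sV (\<lambda>c. f a b c))"

text \<open>
  \<open>is_tensor_product sA sB sC sV t\<close>: the space \<open>V\<close> together with the trilinear map
  \<open>t a b c = a \<otimes> b \<otimes> c\<close> is the tensor product of \<open>A\<close>, \<open>B\<close> and \<open>C\<close>, by its universal
  property. A definition cannot quantify over the type of the target space, so the property is
  required for scalar-valued trilinear maps. For vector spaces this is the full universal
  property: linear forms separate points, so the uniqueness part says that the vectors
  \<open>t a b c\<close> span \<open>V\<close>, and the existence part says that \<open>t\<close> sends triples taken from bases of
  \<open>A\<close>, \<open>B\<close> and \<open>C\<close> to linearly independent vectors.
\<close>
definition is_tensor_product ::
  "(complex \<Rightarrow> 'a \<Rightarrow> 'a) \<Rightarrow> (complex \<Rightarrow> 'b \<Rightarrow> 'b) \<Rightarrow> (complex \<Rightarrow> 'c \<Rightarrow> 'c) \<Rightarrow> (complex \<Rightarrow> 'v \<Rightarrow> 'v)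
    \<Rightarrow> ('a::ab_group_add \<Rightarrow> 'b::ab_group_add \<Rightarrow> 'c::ab_group_add \<Rightarrow> 'v::ab_group_add) \<Rightarrow> bool"
  where "is_tensor_product sA sB sC sV t \<longleftrightarrow>
    vector_space sV \<and> trilinear sA sB sC sV t \<and>
    (\<forall>f. trilinear sA sB sC (*) f \<longrightarrow>
      (\<exists>!g. Vector_Spaces.linear sV (*) g \<and> (\<forall>a b c. g (t a b c) = f a b c)))"

subsection \<open>Polynomials on a vector space\<close>

text \<open>
  The symmetric algebra of the dual space, as the algebra of functions generated by the linear
  forms. Since the field is infinite, a polynomial is determined by its function.
\<close>
inductive_set polynomials :: "(complex \<Rightarrow> 'v \<Rightarrow> 'v) \<Rightarrow> ('v::ab_group_add \<Rightarrow> complex) set"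
  for s :: "complex \<Rightarrow> 'v \<Rightarrow> 'v"
  where
    const: "(\<lambda>v. k) \<in> polynomials s"
  | linear: "Vector_Spaces.linear s (*) l \<Longrightarrow> l \<in> polynomials s"
  | add: "p \<in> polynomials s \<Longrightarrow> q \<in> polynomials s \<Longrightarrow> (\<lambda>v. p v + q v) \<in> polynomials s"
  | mult: "p \<in> polynomials s \<Longrightarrow> q \<in> polynomials s \<Longrightarrow> (\<lambda>v. p v * q v) \<in> polynomials s"

definition forms :: "(complex \<Rightarrow> 'v \<Rightarrow> 'v) \<Rightarrow> nat \<Rightarrow> ('v::ab_group_add \<Rightarrow> complex) set"
  where "forms s d = {p \<in> polynomials s. \<forall>k v. p (s k v) = k ^ d * p v}"

definition polynomial_ring :: "(complex \<Rightarrow> 'v \<Rightarrow> 'v) \<Rightarrow> ('v::ab_group_add \<Rightarrow> complex) ring"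
  where "polynomial_ring s =
    \<lparr>carrier = polynomials s, monoid.mult = (\<lambda>p q v. p v * q v), one = (\<lambda>v. 1),
     zero = (\<lambda>v. 0), add = (\<lambda>p q v. p v + q v)\<rparr>"

lemma cring_polynomial_ring: "cring (polynomial_ring s)"
proof (rule cringI)
  show "abelian_group (polynomial_ring s)"
  proof (rule abelian_groupI)
    fix p assume "p \<in> carrier (polynomial_ring s)"
    then have "(\<lambda>v. (- 1) * p v) \<in> polynomials s"
      using polynomials.mult[OF polynomials.const[of "- 1"]]
      by (simp add: polynomial_ring_def)
    then show "\<exists>q\<in>carrier (polynomial_ring s).
        q \<oplus>\<^bsub>polynomial_ring s\<^esub> p = \<zero>\<^bsub>polynomial_ring s\<^esub>"
      by (intro bexI[of _ "\<lambda>v. (- 1) * p v"]) (simp_all add: polynomial_ring_def)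
  qed (auto simp: polynomial_ring_def algebra_simps intro: polynomials.const polynomials.add)
  show "Group.comm_monoid (polynomial_ring s)"
    by (rule comm_monoidI)
      (auto simp: polynomial_ring_def algebra_simps intro: polynomials.const polynomials.mult)
qed (auto simp: polynomial_ring_def algebra_simps)

subsection \<open>Projective varieties\<close>

text \<open>The class \<open>[v]\<close> of a nonzero vector is represented by the line it spans (including 0).\<close>
definition proj_point :: "(complex \<Rightarrow> 'v \<Rightarrow> 'v) \<Rightarrow> 'v::ab_group_add \<Rightarrow> 'v set"
  where "proj_point s v = module.span s {v}"

definition proj_space :: "(complex \<Rightarrow> 'v \<Rightarrow> 'v) \<Rightarrow> 'v::ab_group_add set set"
  where "proj_space s = {proj_point s v | v. v \<noteq> 0}"

definition zariski_closed :: "(complex \<Rightarrow> 'v \<Rightarrow> 'v) \<Rightarrow> 'v::ab_group_add set set \<Rightarrow> bool"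
  where "zariski_closed s Z \<longleftrightarrow>
    (\<exists>F. F \<subseteq> (\<Union>d. forms s d) \<and> Z = {x \<in> proj_space s. \<forall>f\<in>F. \<forall>v\<in>x. f v = 0})"

definition zariski_closure :: "(complex \<Rightarrow> 'v \<Rightarrow> 'v) \<Rightarrow> 'v::ab_group_add set set \<Rightarrow> 'v set set"
  where "zariski_closure s S = zariski_closed s hull S"

text \<open>
  A polynomial vanishes on \<open>Z\<close> if it vanishes on the affine cone over \<open>Z\<close>. The cone contains
  the origin even if \<open>Z\<close> is empty, which matters only if the projective space itself
  is empty: then the ideal is zero. For nonempty \<open>Z\<close> the origin lies in \<open>\<Union>Z\<close> anyway.
\<close>
definition affine_cone :: "'v::ab_group_add set set \<Rightarrow> 'v set"
  where "affine_cone Z = insert 0 (\<Union>Z)"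

definition vanishing_ideal ::
  "(complex \<Rightarrow> 'v \<Rightarrow> 'v) \<Rightarrow> 'v::ab_group_add set set \<Rightarrow> ('v \<Rightarrow> complex) set"
  where "vanishing_ideal s Z = {p \<in> polynomials s. \<forall>v\<in>affine_cone Z. p v = 0}"

definition segre ::
  "(complex \<Rightarrow> 'v \<Rightarrow> 'v) \<Rightarrow> ('a::zero \<Rightarrow> 'b::zero \<Rightarrow> 'c::zero \<Rightarrow> 'v::ab_group_add) \<Rightarrow> 'v set set"
  where "segre sV t = {proj_point sV (t a b c) | a b c. a \<noteq> 0 \<and> b \<noteq> 0 \<and> c \<noteq> 0}"

text \<open>The line spanned by \<open>x\<close> and \<open>y\<close>; for \<open>x = y\<close> this is just \<open>{x}\<close>.\<close>
definition proj_line :: "(complex \<Rightarrow> 'v \<Rightarrow> 'v) \<Rightarrow> 'v::ab_group_add set \<Rightarrow> 'v set \<Rightarrow> 'v set set"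
  where "proj_line s x y = {z \<in> proj_space s. z \<subseteq> module.span s (x \<union> y)}"

text \<open>
  The points \<open>x\<close> and \<open>y\<close> may coincide, so that \<open>X\<close> is always contained in its secant variety.
  This makes a difference only if \<open>X\<close> is a single point.
\<close>
definition secant_variety :: "(complex \<Rightarrow> 'v \<Rightarrow> 'v) \<Rightarrow> 'v::ab_group_add set set \<Rightarrow> 'v set set"
  where "secant_variety s X = zariski_closure s (\<Union>x\<in>X. \<Union>y\<in>X. proj_line s x y)"

end

(*
  The secant variety is the closure of the set of tensors of multilinear rank at most (2,2,2):
  a generic 2x2x2 tensor is a sum of two decomposable ones, because its pencil of 2x2 slices has
  two distinct singular members.  Hence the cubics needed are the 3x3 minors of the three
  flattenings, and one has to show I(R) = I(R_A) + I(R_B) + I(R_C), where R_A, R_B, R_C are the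
  tensors whose respective flattening has rank at most 2 and R is their intersection.

  In degree d, the powers <T,v>^d with v in a set S span the orthogonal complement of the forms
  vanishing on S, so every form is a form vanishing on R_A plus powers <T,v>^d with v in R_A.
  Such a v is the image of some v' under an endomorphism of A of rank at most 2, which commutes
  with endomorphisms of B and C; splitting <T,v'>^d in the same way for R_B, and then for R_C, leaves
  a combination of powers <T,v>^d with v in R, and if it vanishes on R it is zero.

  That I(R_A) is generated by minors is a straightening argument.  Give the monomial m in the matrix
  entries x_ij the weight sum of i*j.  A monomial with a strict antidiagonal of length 3 is, modulo a
  minor, a combination of monomials of larger weight.  The remaining monomials are independent on
  x_ij = s_i y_j + t_i z_j: such a monomial m is a product of two chains, and by the rearrangement
  inequality every other monomial whose expansion contains the product of the two chains, the first
  in s, y and the second in t, z, has smaller weight than m.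
*)
theory Submission
  imports Defs "HOL-Library.Multiset" "HOL-Library.Function_Algebras"
    "HOL-Computational_Algebra.Polynomial"
begin

subsection \<open>Polynomial functions on coordinate space\<close>

interpretation fn: vector_space "\<lambda>(c::complex) (f::'x \<Rightarrow> complex) x. c * f x"
  by unfold_locales (auto simp: fun_eq_iff algebra_simps)

definition mon :: "'n multiset \<Rightarrow> ('n \<Rightarrow> complex) \<Rightarrow> complex"
  where "mon m T = (\<Prod>n\<in>#m. T n)"

lemma mon_simps [simp]:
  "mon {#} T = 1" "mon (add_mset n m) T = T n * mon m T" "mon (m + m') T = mon m T * mon m' T"
  by (simp_all add: mon_def)

lemma mon_cong: "(\<And>n. n \<in># m \<Longrightarrow> T n = T' n) \<Longrightarrow> mon m T = mon m T'"
  by (induction m) auto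

lemma mon_image_mset: "mon (image_mset f m) T = mon m (\<lambda>n. T (f n))"
  by (simp add: mon_def multiset.map_comp comp_def)

lemma mon_scale: "mon m (\<lambda>n. k * T n) = k ^ size m * mon m T"
  by (induction m) auto

lemma mon_decompose:
  "mon m T = T u ^ count m u * mon (filter_mset (\<lambda>n. n \<noteq> u) m) T"
  by (induction m) auto

text \<open>Induction on the variables: with all values except that at \<open>u\<close> fixed, the
  sum is a polynomial function of one number, so each of its coefficients vanishes. Several
  \<open>j\<close> may carry the same monomial, as happens after expanding products, so only total
  coefficients are determined.\<close>

lemma mon_independent:
  assumes "finite J" "finite U" "\<And>j. j \<in> J \<Longrightarrow> set_mset (\<beta> j) \<subseteq> U"
    and "\<And>T. (\<Sum>j\<in>J. \<gamma> j * mon (\<beta> j) T) = 0"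
  shows "(\<Sum>j | j \<in> J \<and> \<beta> j = b. \<gamma> j) = 0"
  using assms(2,1,3-)
proof (induction U arbitrary: J \<beta> b rule: finite_induct)
  case empty
  then have *: "\<beta> j = {#}" if "j \<in> J" for j using that by auto
  have "(\<Sum>j\<in>J. \<gamma> j) = (\<Sum>j\<in>J. \<gamma> j * mon (\<beta> j) (\<lambda>_. 0))" 
    by (rule sum.cong) (auto simp: *)
  also have "\<dots> = 0" using empty.prems(3) .
  finally have "(\<Sum>j\<in>J. \<gamma> j) = 0" .
  moreover have "{j. j \<in> J \<and> \<beta> j = b} = (if b = {#} then J else {})" using * by auto
  ultimately show ?case by simp
next
  case (insert u U)
  define rest where "rest j = filter_mset (\<lambda>n. n \<noteq> u) (\<beta> j)" for j
  define K where "K = Max (insert 0 ((\<lambda>j. count (\<beta> j) u) ` J))"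
  have K: "count (\<beta> j) u \<le> K" if "j \<in> J" for j
    unfolding K_def using that insert.prems(1) by simp
  define Jk where "Jk k = {j \<in> J. count (\<beta> j) u = k}" for k
  have *: "(\<Sum>j\<in>Jk k. \<gamma> j * mon (rest j) T) = 0" for k T
  proof (cases "k \<le> K")
    case True
    have "(\<Sum>k\<le>K. (\<Sum>j\<in>Jk k. \<gamma> j * mon (rest j) T) * x ^ k) = 0" for x
    proof -
      have rest: "mon (rest j) (T(u := x)) = mon (rest j) T" for j
        by (rule mon_cong) (auto simp: rest_def)
      have "(\<Sum>k\<le>K. (\<Sum>j\<in>Jk k. \<gamma> j * mon (rest j) T) * x ^ k)
        = (\<Sum>k\<le>K. \<Sum>j\<in>Jk k. \<gamma> j * mon (\<beta> j) (T(u := x)))"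
        unfolding sum_distrib_right
      proof (intro sum.cong refl)
        fix k j assume "j \<in> Jk k"
        then show "\<gamma> j * mon (rest j) T * x ^ k = \<gamma> j * mon (\<beta> j) (T(u := x))"
          using mon_decompose[of "\<beta> j" "T(u := x)" u] rest[of j]
          by (simp add: Jk_def rest_def)
      qed
      also have "\<dots> = (\<Sum>j\<in>J. \<gamma> j * mon (\<beta> j) (T(u := x)))"
        unfolding Jk_def
        by (rule sum.group[OF insert.prems(1)]) (use K in auto)
      finally show ?thesis using insert.prems(3) by simp
    qed
    then show ?thesis using True polyfun_eq_0[of "\<lambda>k. \<Sum>j\<in>Jk k. \<gamma> j * mon (rest j) T" K] by auto
  next
    case False
    then have "Jk k = {}" using K by (auto simp: Jk_def)
    then show ?thesis by simp
  qed
  have "(\<Sum>j | j \<in> Jk (count b u) \<and> rest j = filter_mset (\<lambda>n. n \<noteq> u) b. \<gamma> j) = 0"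
  proof (rule insert.IH)
    show "finite (Jk (count b u))" using insert.prems(1) by (simp add: Jk_def)
    show "set_mset (rest j) \<subseteq> U" if "j \<in> Jk (count b u)" for j
      using insert.prems(2)[of j] that by (auto simp: Jk_def rest_def)
  qed (rule *)
  moreover have "{j. j \<in> Jk (count b u) \<and> rest j = filter_mset (\<lambda>n. n \<noteq> u) b} = {j. j \<in> J \<and> \<beta> j = b}"
  proof -
    have "\<beta> j = b" if "count (\<beta> j) u = count b u" "rest j = filter_mset (\<lambda>n. n \<noteq> u) b" for j
    proof (rule multiset_eqI)
      fix n
      have "count (rest j) n = count (filter_mset (\<lambda>n. n \<noteq> u) b) n" using that(2) by simp
      then show "count (\<beta> j) n = count b n"
        using that(1) by (cases "n = u") (simp_all add: rest_def)
    qed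
    then show ?thesis by (auto simp: Jk_def rest_def)
  qed
  ultimately show ?case by simp
qed

definition Pol :: "'n set \<Rightarrow> nat \<Rightarrow> (('n \<Rightarrow> complex) \<Rightarrow> complex) set"
  where "Pol N d = fn.span {mon m | m. size m = d \<and> set_mset m \<subseteq> N}"

lemma finite_msets: "finite N \<Longrightarrow> finite {m. size m = d \<and> set_mset m \<subseteq> N}"
proof -
  assume "finite N"
  have "{m. size m = d \<and> set_mset m \<subseteq> N} \<subseteq> mset ` {w. set w \<subseteq> N \<and> length w = d}"
  proof
    fix m :: "'a multiset" assume "m \<in> {m. size m = d \<and> set_mset m \<subseteq> N}"
    moreover obtain w where "mset w = m" using ex_mset by blast
    ultimately show "m \<in> mset ` {w. set w \<subseteq> N \<and> length w = d}" by auto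
  qed
  then show ?thesis
    by (rule finite_subset) (simp add: finite_lists_length_eq[OF \<open>finite N\<close>])
qed

lemma span_image_finite:
  assumes "finite M" "f \<in> fn.span (g ` M)"
  obtains c where "\<And>T. f T = (\<Sum>m\<in>M. c m * g m T)"
proof -
  have "\<exists>c. \<forall>T. f T = (\<Sum>m\<in>M. c m * g m T)"
    using assms(2)
  proof (induction rule: fn.span_induct_alt)
    case base
    then show ?case by (intro exI[of _ "\<lambda>_. 0"]) simp
  next
    case (step k x y)
    then obtain c m0 where c: "\<And>T. y T = (\<Sum>m\<in>M. c m * g m T)" and m0: "m0 \<in> M" "x = g m0" by auto
    have "k * x T + y T = (\<Sum>m\<in>M. (c m + (if m = m0 then k else 0)) * g m T)" for T
    proof -
      have "(\<Sum>m\<in>M. (c m + (if m = m0 then k else 0)) * g m T)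
         = (\<Sum>m\<in>M. c m * g m T + (if m = m0 then k * g m T else 0))"
        by (rule sum.cong) (auto simp: algebra_simps)
      also have "\<dots> = y T + k * g m0 T"
        using assms(1) m0 by (simp add: sum.distrib c)
      finally show ?thesis using m0 by simp
    qed
    then show ?case by (intro exI[of _ "\<lambda>m. c m + (if m = m0 then k else 0)"]) simp
  qed
  then show ?thesis using that by blast
qed

lemma Pol_cong:
  assumes "f \<in> Pol N d" "\<And>n. n \<in> N \<Longrightarrow> T n = T' n"
  shows "f T = f T'"
  using assms(1) unfolding Pol_def
proof (induction rule: fn.span_induct_alt)
  case (step k x y)
  then obtain m where "x = mon m" "set_mset m \<subseteq> N" by auto
  then have "x T = x T'" using assms(2) by (auto intro: mon_cong)
  then show ?case using step by simp
qed simp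

lemma Pol_scale:
  assumes "f \<in> Pol N d"
  shows "f (\<lambda>n. k * T n) = k ^ d * f T"
  using assms unfolding Pol_def
proof (induction rule: fn.span_induct_alt)
  case (step c x y)
  then show ?case by (auto simp: mon_scale algebra_simps)
qed simp

text \<open>Restricting to a line turns density arguments into statements about polynomials in one
  variable.\<close>

lemma Pol_line:
  assumes "f \<in> Pol N d"
  obtains q where "\<And>u. f (\<lambda>n. \<alpha> n + u * \<beta> n) = poly q u"
proof -
  have mon: "\<exists>q. \<forall>u. mon m (\<lambda>n. \<alpha> n + u * \<beta> n) = poly q u" for m
  proof (induction m)
    case empty
    show ?case by (intro exI[of _ 1]) simp
  next
    case (add n m)
    then obtain q where "\<And>u. mon m (\<lambda>n. \<alpha> n + u * \<beta> n) = poly q u" by blast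
    then show ?case by (intro exI[of _ "[:\<alpha> n, \<beta> n:] * q"]) (simp add: algebra_simps)
  qed
  have "\<exists>q. \<forall>u. f (\<lambda>n. \<alpha> n + u * \<beta> n) = poly q u"
    using assms unfolding Pol_def
  proof (induction rule: fn.span_induct_alt)
    case base
    show ?case by (intro exI[of _ 0]) simp
  next
    case (step c x y)
    then obtain m q where *: "x = mon m" "\<And>u. y (\<lambda>n. \<alpha> n + u * \<beta> n) = poly q u" by blast
    obtain q' where "\<And>u. mon m (\<lambda>n. \<alpha> n + u * \<beta> n) = poly q' u" using mon by blast
    with * show ?case by (intro exI[of _ "smult c q' + q"]) simp
  qed
  then show ?thesis using that by blast
qed

subsection \<open>The Hermitian product on forms of degree d\<close>

text \<open>Orthogonal projection onto \<open>U\<close> by Gram-Schmidt, one index at a time: the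
  members of \<open>U\<close> vanishing at \<open>w0\<close> form a subspace of codimension at most
  one, to which the induction hypothesis applies.\<close>

lemma hermitian_projection:
  assumes "finite W" "fn.subspace U"
  shows "\<exists>h\<in>U. \<forall>u\<in>U. (\<Sum>w\<in>W. (c w - h w) * cnj (u w)) = 0"
  using assms
proof (induction W arbitrary: U c rule: finite_induct)
  case empty
  then show ?case using fn.subspace_0 by fastforce
next
  case (insert w0 W U c)
  define U0 where "U0 = {u \<in> U. u w0 = 0}"
  have U0: "fn.subspace U0"
    using insert.prems unfolding U0_def fn.subspace_def by auto
  have IH: "\<exists>h\<in>U0. \<forall>u\<in>U0. (\<Sum>w\<in>insert w0 W. (c w - h w) * cnj (u w)) = 0" for c
    using insert.IH[OF U0, of c] insert.hyps by (auto simp: U0_def)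
  show ?case
  proof (cases "U = U0")
    case True
    then show ?thesis using IH by blast
  next
    case False
    then obtain v where v: "v \<in> U" "v w0 \<noteq> 0" by (auto simp: U0_def)
    obtain p where p: "p \<in> U0" "\<And>u. u \<in> U0 \<Longrightarrow> (\<Sum>w\<in>insert w0 W. (v w - p w) * cnj (u w)) = 0"
      using IH[of v] by blast
    obtain q where q: "q \<in> U0" "\<And>u. u \<in> U0 \<Longrightarrow> (\<Sum>w\<in>insert w0 W. (c w - q w) * cnj (u w)) = 0"
      using IH[of c] by blast
    \<comment> \<open>Subtracting from \<open>v\<close> its projection to \<open>U0\<close> leaves a
      vector orthogonal to \<open>U0\<close>. It is nonzero at \<open>w0\<close>, hence spans a
      complement of \<open>U0\<close> in \<open>U\<close>.\<close>
    define n where "n = (\<lambda>w. v w - p w)"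
    have nU: "n \<in> U" 
      using fn.subspace_diff[OF insert.prems v(1), of p] p(1) by (auto simp: U0_def n_def fun_diff_def)
    have n0: "n w0 = v w0" using p(1) by (simp add: n_def U0_def)
    define nn where "nn = (\<Sum>w\<in>insert w0 W. n w * cnj (n w))"
    have "nn = complex_of_real (\<Sum>w\<in>insert w0 W. (cmod (n w))\<^sup>2)"
      unfolding nn_def of_real_sum complex_norm_square by simp
    moreover have "(\<Sum>w\<in>insert w0 W. (cmod (n w))\<^sup>2) \<ge> (cmod (n w0))\<^sup>2"
      using insert.hyps by (simp add: sum_nonneg)
    ultimately have nn: "nn \<noteq> 0" using n0 v(2)
      by (smt (verit) of_real_eq_0_iff zero_less_norm_iff zero_less_power)
    define k where "k = (\<Sum>w\<in>insert w0 W. (c w - q w) * cnj (n w)) / nn"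
    define h where "h = (\<lambda>w. q w + k * n w)"
    have hU: "h \<in> U"
      using fn.subspace_add[OF insert.prems, of q "\<lambda>w. k * n w"]
        fn.subspace_scale[OF insert.prems nU, of k] q(1)
      by (auto simp: U0_def h_def plus_fun_def)
    have ortho: "(\<Sum>w\<in>insert w0 W. (c w - h w) * cnj (u w)) = 0" if "u \<in> U0" for u
    proof -
      have "(\<Sum>w\<in>insert w0 W. (c w - h w) * cnj (u w))
        = (\<Sum>w\<in>insert w0 W. (c w - q w) * cnj (u w) - k * ((v w - p w) * cnj (u w)))"
        by (rule sum.cong) (auto simp: h_def n_def algebra_simps)
      also have "\<dots> = 0" 
        unfolding sum_subtractf sum_distrib_left[symmetric] using p(2) q(2) that by simp
      finally show ?thesis .
    qed
    have ortho_n: "(\<Sum>w\<in>insert w0 W. (c w - h w) * cnj (n w)) = 0"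
    proof -
      have "(\<Sum>w\<in>insert w0 W. (c w - h w) * cnj (n w))
        = (\<Sum>w\<in>insert w0 W. (c w - q w) * cnj (n w) - k * (n w * cnj (n w)))"
        by (rule sum.cong) (auto simp: h_def algebra_simps)
      also have "\<dots> = k * nn - k * nn" 
        unfolding sum_subtractf sum_distrib_left[symmetric] nn_def[symmetric]
        using nn by (simp add: k_def)
      finally show ?thesis by simp
    qed
    have "(\<Sum>w\<in>insert w0 W. (c w - h w) * cnj (u w)) = 0" if "u \<in> U" for u
    proof -
      define a where "a = u w0 / n w0"
      define u0 where "u0 = (\<lambda>w. u w - a * n w)"
      have "u0 \<in> U"
        using fn.subspace_diff[OF insert.prems that fn.subspace_scale[OF insert.prems nU, of a]]
        by (simp add: u0_def fun_diff_def)
      then have "u0 \<in> U0" using n0 v(2) by (simp add: U0_def u0_def a_def)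
      have "(\<Sum>w\<in>insert w0 W. (c w - h w) * cnj (u w))
        = (\<Sum>w\<in>insert w0 W. (c w - h w) * cnj (u0 w) + cnj a * ((c w - h w) * cnj (n w)))"
        by (rule sum.cong) (auto simp: u0_def algebra_simps)
      also have "\<dots> = 0"
        unfolding sum.distrib sum_distrib_left[symmetric] using ortho[OF \<open>u0 \<in> U0\<close>] ortho_n by simp
      finally show ?thesis .
    qed
    then show ?thesis using hU by blast
  qed
qed

lemma sum_fun_apply: "(\<Sum>i\<in>A. F i) T = (\<Sum>i\<in>A. F i T :: complex)"
  by (induction A rule: infinite_finite_induct) auto

section \<open>Forms with coefficients indexed by words\<close>

definition words :: "'n set \<Rightarrow> nat \<Rightarrow> 'n list set"
  where "words N d = {w. set w \<subseteq> N \<and> length w = d}"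

lemma finite_words: "finite N \<Longrightarrow> finite (words N d)"
  by (simp add: words_def finite_lists_length_eq)

text \<open>Words rather than monomials index the coefficients: expanding a d-th power then produces
  no multinomial factors, and the plain Hermitian product of coefficient functions pairs a form with
  the power at \<open>v\<close> to give its value at \<open>v\<close>.\<close>

definition word_form :: "'n set \<Rightarrow> nat \<Rightarrow> ('n list \<Rightarrow> complex) \<Rightarrow> ('n \<Rightarrow> complex) \<Rightarrow> complex"
  where "word_form N d c T = (\<Sum>w\<in>words N d. c w * mon (mset w) T)"

text \<open>The power \<open>\<langle>T, v\<rangle>\<^sup>d\<close>, which reproduces the value at \<open>v\<close> of a form of degree \<open>d\<close>.\<close>
definition form_power :: "'n set \<Rightarrow> nat \<Rightarrow> ('n \<Rightarrow> complex) \<Rightarrow> ('n \<Rightarrow> complex) \<Rightarrow> complex"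
  where "form_power N d v T = (\<Sum>n\<in>N. T n * cnj (v n)) ^ d"

lemma form_power_eq:
  assumes "finite N"
  shows "form_power N d v = word_form N d (\<lambda>w. cnj (mon (mset w) v))"
proof
  fix T
  show "form_power N d v T = word_form N d (\<lambda>w. cnj (mon (mset w) v)) T"
  proof (induction d)
    case 0
    have "words N 0 = {[]}" by (auto simp: words_def)
    then show ?case by (simp add: form_power_def word_form_def)
  next
    case (Suc d)
    have "word_form N (Suc d) (\<lambda>w. cnj (mon (mset w) v)) T
      = (\<Sum>(n, w)\<in>N \<times> words N d. cnj (mon (mset (n # w)) v) * mon (mset (n # w)) T)"
      unfolding word_form_def
      by (rule sum.reindex_bij_witness[of _ "\<lambda>(n, w). n # w" "\<lambda>w. (hd w, tl w)"])
        (auto simp: words_def length_Suc_conv)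
    also have "\<dots> = (\<Sum>n\<in>N. T n * cnj (v n)) * word_form N d (\<lambda>w. cnj (mon (mset w) v)) T"
      unfolding word_form_def sum_product sum.cartesian_product
      by (rule sum.cong) auto
    finally show ?case using Suc by (simp add: form_power_def)
  qed
qed

lemma word_form_Pol:
  shows "word_form N d c \<in> Pol N d"
proof -
  have "(\<lambda>T. c w * mon (mset w) T) \<in> Pol N d" if "w \<in> words N d" for w
    unfolding Pol_def by (rule fn.span_scale[OF fn.span_base]) (use that in \<open>auto simp: words_def intro!: exI[of _ "mset w"]\<close>)
  then have "(\<Sum>w\<in>words N d. (\<lambda>T. c w * mon (mset w) T)) \<in> Pol N d"
    unfolding Pol_def by (rule fn.span_sum)
  also have "(\<Sum>w\<in>words N d. (\<lambda>T. c w * mon (mset w) T)) = word_form N d c"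
    by (auto simp: word_form_def fun_eq_iff sum_fun_apply)
  finally show ?thesis .
qed

lemma form_power_Pol: "finite N \<Longrightarrow> form_power N d v \<in> Pol N d"
  by (simp add: form_power_eq word_form_Pol)

lemma Pol_word_form:
  assumes "finite N" "f \<in> Pol N d"
  obtains c where "f = word_form N d c"
proof -
  have "mon ` {m. size m = d \<and> set_mset m \<subseteq> N} \<subseteq> (\<lambda>w. mon (mset w)) ` words N d"
  proof
    fix f :: "('a \<Rightarrow> complex) \<Rightarrow> complex" assume "f \<in> mon ` {m. size m = d \<and> set_mset m \<subseteq> N}"
    then obtain m where "f = mon m" "size m = d" "set_mset m \<subseteq> N" by auto
    moreover obtain w where "mset w = m" using ex_mset by blast
    ultimately show "f \<in> (\<lambda>w. mon (mset w)) ` words N d" by (auto simp: words_def)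
  qed
  then have "f \<in> fn.span ((\<lambda>w. mon (mset w)) ` words N d)"
    using assms(2) fn.span_mono[of "mon ` {m. size m = d \<and> set_mset m \<subseteq> N}"]
    unfolding Pol_def setcompr_eq_image by blast
  then show ?thesis
  proof (rule span_image_finite[OF finite_words[OF assms(1)]])
    fix c assume "\<And>T. f T = (\<Sum>w\<in>words N d. c w * mon (mset w) T)"
    then have "f = word_form N d c" by (simp add: word_form_def fun_eq_iff)
    then show thesis by (rule that)
  qed
qed

lemma word_form_span:
  assumes "finite N" "h \<in> fn.span ((\<lambda>v w. cnj (mon (mset w) v)) ` R)"
  shows "word_form N d h \<in> fn.span (form_power N d ` R)"
  using assms(2)
proof (induction rule: fn.span_induct_alt)
  case base
  have "word_form N d 0 = (0 :: ('a \<Rightarrow> complex) \<Rightarrow> complex)" by (auto simp: word_form_def fun_eq_iff)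
  then show ?case by (metis fn.span_zero)
next
  case (step k x y)
  then obtain v where v: "v \<in> R" "x = (\<lambda>w. cnj (mon (mset w) v))" by auto
  have "word_form N d ((\<lambda>w. k * x w) + y) = (\<lambda>T. k * form_power N d v T) + word_form N d y"
    using v by (auto simp: form_power_eq[OF assms(1)] word_form_def fun_eq_iff algebra_simps sum.distrib sum_distrib_left)
  moreover have "(\<lambda>T. k * form_power N d v T) \<in> fn.span (form_power N d ` R)"
    by (rule fn.span_scale[OF fn.span_base]) (use v in auto)
  ultimately show ?case using step by (metis fn.span_add)
qed

text \<open>A form has many coefficient functions; the one found here lies in the span of those of
  the powers, so that it can later be shown orthogonal to itself.\<close>

lemma span_word_form:
  assumes "finite N" "f \<in> fn.span (form_power N d ` R)"
  obtains h where "h \<in> fn.span ((\<lambda>v w. cnj (mon (mset w) v)) ` R)" "f = word_form N d h"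
proof -
  have "\<exists>h \<in> fn.span ((\<lambda>v w. cnj (mon (mset w) v)) ` R). f = word_form N d h"
    using assms(2)
  proof (induction rule: fn.span_induct_alt)
    case base
    show ?case by (intro bexI[of _ 0]) (auto simp: word_form_def fun_eq_iff fn.span_zero)
  next
    case (step k x y)
    then obtain v h where v: "v \<in> R" "x = form_power N d v"
      and h: "h \<in> fn.span ((\<lambda>v w. cnj (mon (mset w) v)) ` R)" "y = word_form N d h" by auto
    let ?h = "(\<lambda>w. k * cnj (mon (mset w) v)) + h"
    have "(\<lambda>T. k * x T) + y = word_form N d ?h"
      using v h by (auto simp: form_power_eq[OF assms(1)] word_form_def fun_eq_iff algebra_simps sum.distrib sum_distrib_left)
    moreover have "?h \<in> fn.span ((\<lambda>v w. cnj (mon (mset w) v)) ` R)"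
      by (rule fn.span_add[OF fn.span_scale[OF fn.span_base] h(1)]) (use v in auto)
    ultimately show ?case by blast
  qed
  then show ?thesis using that by blast
qed

section \<open>Forms modulo those vanishing on a set\<close>

definition vanishing :: "'n set \<Rightarrow> nat \<Rightarrow> ('n \<Rightarrow> complex) set \<Rightarrow> (('n \<Rightarrow> complex) \<Rightarrow> complex) set"
  where "vanishing N d R = {f \<in> Pol N d. \<forall>T\<in>R. f T = 0}"

lemma subspace_vanishing: "fn.subspace (vanishing N d R)"
  unfolding fn.subspace_def vanishing_def Pol_def
  by (auto simp: fn.span_zero fn.span_add fn.span_scale)

text \<open>Project the coefficients of \<open>f\<close> orthogonally to the span of those of the
  powers at points of \<open>R\<close>. The projection gives a combination of powers, and
  orthogonality of the remainder to the power at \<open>v\<close> says that its value at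
  \<open>v\<close> is zero.\<close>

lemma Pol_decomposition:
  assumes "finite N" "f \<in> Pol N d"
  shows "f \<in> fn.span (vanishing N d R \<union> form_power N d ` R)"
proof -
  obtain c where f: "f = word_form N d c" using assms by (rule Pol_word_form)
  let ?E = "(\<lambda>v w. cnj (mon (mset w) v)) ` R"
  have "\<exists>h\<in>fn.span ?E. \<forall>u\<in>fn.span ?E. (\<Sum>w\<in>words N d. (c w - h w) * cnj (u w)) = 0"
    by (rule hermitian_projection[OF finite_words[OF assms(1)] fn.subspace_span])
  then obtain h where h: "h \<in> fn.span ?E"
    "\<And>u. u \<in> fn.span ?E \<Longrightarrow> (\<Sum>w\<in>words N d. (c w - h w) * cnj (u w)) = 0"
    by blast
  have "word_form N d (\<lambda>w. c w - h w) v = 0" if "v \<in> R" for v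
    using h(2)[of "\<lambda>w. cnj (mon (mset w) v)"] that by (simp add: word_form_def fn.span_base)
  then have "word_form N d (\<lambda>w. c w - h w) \<in> vanishing N d R"
    by (simp add: vanishing_def word_form_Pol)
  then have 1: "word_form N d (\<lambda>w. c w - h w) \<in> fn.span (vanishing N d R \<union> form_power N d ` R)"
    by (simp add: fn.span_base)
  have 2: "word_form N d h \<in> fn.span (vanishing N d R \<union> form_power N d ` R)"
    using word_form_span[OF assms(1) h(1), of d] fn.span_mono[of "form_power N d ` R"] by blast
  have "f = word_form N d (\<lambda>w. c w - h w) + word_form N d h"
    by (auto simp: f word_form_def fun_eq_iff algebra_simps sum.distrib[symmetric])
  then show ?thesis using fn.span_add[OF 1 2] by simp
qed

text \<open>The value at \<open>v\<close> is the Hermitian product with the coefficients of the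
  power at \<open>v\<close>. Vanishing on \<open>R\<close> thus makes the coefficients
  \<open>h\<close> orthogonal to a span that contains \<open>h\<close>, so the squares of their
  absolute values sum to zero.\<close>

lemma span_form_power_vanishing:
  assumes "finite N" "f \<in> fn.span (form_power N d ` R)" "\<And>T. T \<in> R \<Longrightarrow> f T = 0"
  shows "f = 0"
proof -
  obtain h where h: "h \<in> fn.span ((\<lambda>v w. cnj (mon (mset w) v)) ` R)" "f = word_form N d h"
    using assms(1,2) by (rule span_word_form)
  have "(\<Sum>w\<in>words N d. h w * cnj (u w)) = 0"
    if "u \<in> fn.span ((\<lambda>v w. cnj (mon (mset w) v)) ` R)" for u
    using that
  proof (induction rule: fn.span_induct_alt)
    case (step k x y)
    then obtain v where v: "v \<in> R" "x = (\<lambda>w. cnj (mon (mset w) v))" by auto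
    have "(\<Sum>w\<in>words N d. h w * cnj (((\<lambda>w. k * x w) + y) w))
      = cnj k * word_form N d h v + (\<Sum>w\<in>words N d. h w * cnj (y w))"
      using v by (simp add: word_form_def algebra_simps sum.distrib sum_distrib_left)
    also have "\<dots> = 0" using step h(2) assms(3) v by simp
    finally show ?case .
  qed simp
  from this[OF h(1)] have "(\<Sum>w\<in>words N d. complex_of_real ((cmod (h w))\<^sup>2)) = 0"
    unfolding complex_norm_square .
  then have "(\<Sum>w\<in>words N d. (cmod (h w))\<^sup>2) = 0"
    unfolding of_real_sum[symmetric] of_real_eq_0_iff .
  then have "h w = 0" if "w \<in> words N d" for w
    using that by (simp add: sum_nonneg_eq_0_iff finite_words[OF assms(1)])
  then show ?thesis using h(2) by (auto simp: word_form_def fun_eq_iff)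
qed

text \<open>Precomposing with the adjoint \<open>\<Psi>\<close> turns the power at \<open>v\<close>
  into the power at \<open>\<Phi> v\<close>. Decompose the power at \<open>v\<close> relative to
  \<open>R\<close> and precompose: forms vanishing on \<open>R\<close> keep this property because
  \<open>\<Psi>\<close> maps \<open>R\<close> to itself.\<close>

lemma form_power_image:
  assumes "finite N"
    and adj: "\<And>v T. (\<Sum>n\<in>N. T n * cnj (\<Phi> v n)) = (\<Sum>n\<in>N. \<Psi> T n * cnj (v n))"
    and inv: "\<And>T. T \<in> R \<Longrightarrow> \<Psi> T \<in> R"
  shows "form_power N d (\<Phi> v) \<in> fn.span (vanishing N d R \<union> form_power N d ` \<Phi> ` R)"
proof -
  have comp: "form_power N d (\<Phi> v) = (\<lambda>T. form_power N d v (\<Psi> T))" for v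
    by (rule ext) (simp add: form_power_def adj)
  obtain x y where xy: "x \<in> vanishing N d R" "y \<in> fn.span (form_power N d ` R)"
      "form_power N d v = x + y"
    using Pol_decomposition[OF assms(1) form_power_Pol[OF assms(1)], of d v R]
    unfolding fn.span_Un by (auto simp: fn.span_eq_iff[THEN iffD2, OF subspace_vanishing])
  have y: "(\<lambda>T. y (\<Psi> T)) \<in> fn.span (form_power N d ` \<Phi> ` R)"
    using xy(2)
  proof (induction rule: fn.span_induct_alt)
    case base
    then show ?case using fn.span_zero by (simp add: zero_fun_def)
  next
    case (step k x y)
    then obtain u where u: "u \<in> R" "x = form_power N d u" by auto
    have "(\<lambda>T. k * form_power N d (\<Phi> u) T) \<in> fn.span (form_power N d ` \<Phi> ` R)"
      by (rule fn.span_scale[OF fn.span_base]) (use u in auto)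
    from fn.span_add[OF this step.IH] show ?case using u by (simp add: comp plus_fun_def)
  qed
  \<comment> \<open>That \<open>x\<close> composed with \<open>\<Psi>\<close> is again a form is
    read off from this difference of two forms.\<close>
  have eq: "(\<lambda>T. x (\<Psi> T)) = form_power N d (\<Phi> v) - (\<lambda>T. y (\<Psi> T))"
    using xy(3) by (auto simp: fun_eq_iff comp)
  have "fn.span (form_power N d ` \<Phi> ` R) \<subseteq> Pol N d"
    by (rule fn.span_minimal) (auto simp: form_power_Pol assms(1), simp add: Pol_def)
  then have "(\<lambda>T. x (\<Psi> T)) \<in> Pol N d"
    using y form_power_Pol[OF assms(1)] fn.span_diff unfolding eq Pol_def by blast
  then have x: "(\<lambda>T. x (\<Psi> T)) \<in> vanishing N d R"
    using xy(1) inv by (simp add: vanishing_def)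
  have "form_power N d (\<Phi> v) = (\<lambda>T. x (\<Psi> T)) + (\<lambda>T. y (\<Psi> T))"
    unfolding eq by simp
  moreover have "(\<lambda>T. y (\<Psi> T)) \<in> fn.span (vanishing N d R \<union> form_power N d ` \<Phi> ` R)"
    using y fn.span_mono[of "form_power N d ` \<Phi> ` R" "vanishing N d R \<union> form_power N d ` \<Phi> ` R"] by blast
  ultimately show ?thesis using fn.span_add[OF fn.span_base] x by (metis UnI1)
qed

text \<open>The three families will be endomorphisms of the three tensor factors. Powers at points
  of \<open>R1\<close> are reduced to powers at points reached by two families and then by all
  three, each time modulo forms vanishing on \<open>R2\<close> or \<open>R3\<close>.\<close>

lemma vanishing_triple_product:
  fixes \<Phi>1 :: "'g \<Rightarrow> ('n \<Rightarrow> complex) \<Rightarrow> 'n \<Rightarrow> complex"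
    and \<Phi>2 :: "'h \<Rightarrow> ('n \<Rightarrow> complex) \<Rightarrow> 'n \<Rightarrow> complex"
    and \<Phi>3 :: "'k \<Rightarrow> ('n \<Rightarrow> complex) \<Rightarrow> 'n \<Rightarrow> complex"
    and G1 :: "'g set" and G2 :: "'h set" and G3 :: "'k set"
  defines "R1 \<equiv> {\<Phi>1 g T | g T. g \<in> G1}"
    and "R2 \<equiv> {\<Phi>2 g T | g T. g \<in> G2}"
    and "R3 \<equiv> {\<Phi>3 g T | g T. g \<in> G3}"
    and "R \<equiv> {\<Phi>1 g (\<Phi>2 h (\<Phi>3 k T)) | g h k T. g \<in> G1 \<and> h \<in> G2 \<and> k \<in> G3}"
  assumes N: "finite N"
    and adj1: "\<And>g. g \<in> G1 \<Longrightarrow> s1 g \<in> G1" "\<And>g T v. (\<Sum>n\<in>N. T n * cnj (\<Phi>1 g v n)) = (\<Sum>n\<in>N. \<Phi>1 (s1 g) T n * cnj (v n))"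
    and adj2: "\<And>g. g \<in> G2 \<Longrightarrow> s2 g \<in> G2" "\<And>g T v. (\<Sum>n\<in>N. T n * cnj (\<Phi>2 g v n)) = (\<Sum>n\<in>N. \<Phi>2 (s2 g) T n * cnj (v n))"
    and comm12: "\<And>g h T. \<Phi>1 g (\<Phi>2 h T) = \<Phi>2 h (\<Phi>1 g T)"
    and comm13: "\<And>g h T. \<Phi>1 g (\<Phi>3 h T) = \<Phi>3 h (\<Phi>1 g T)"
    and comm23: "\<And>g h T. \<Phi>2 g (\<Phi>3 h T) = \<Phi>3 h (\<Phi>2 g T)"
    and f: "f \<in> vanishing N d R"
  shows "f \<in> fn.span (vanishing N d R1 \<union> vanishing N d R2 \<union> vanishing N d R3)"
proof -
  define I where "I = vanishing N d R1 \<union> vanishing N d R2 \<union> vanishing N d R3"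
  define S where "S = fn.span (I \<union> form_power N d ` R)"
  have S_I: "x \<in> S" if "x \<in> fn.span (J \<union> form_power N d ` Q)" "J \<subseteq> I" "form_power N d ` Q \<subseteq> S" for x J Q
  proof -
    have "J \<union> form_power N d ` Q \<subseteq> S" using that by (auto simp: S_def intro: fn.span_base)
    then have "fn.span (J \<union> form_power N d ` Q) \<subseteq> S"
      unfolding S_def by (intro fn.span_minimal) auto
    then show ?thesis using that by blast
  qed
  have R: "form_power N d ` R \<subseteq> S" by (auto simp: S_def intro: fn.span_base)
  \<comment> \<open>The map here is a composite from the first two families. Its adjoint is the
    composite of the adjoints in reverse order and preserves \<open>R3\<close>, since it commutes
    with the third family.\<close>
  have step2: "form_power N d (\<Phi>1 g (\<Phi>2 h T)) \<in> S" if "g \<in> G1" "h \<in> G2" for g h T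
  proof (rule S_I)
    show "form_power N d (\<Phi>1 g (\<Phi>2 h T))
      \<in> fn.span (vanishing N d R3 \<union> form_power N d ` (\<lambda>T. \<Phi>1 g (\<Phi>2 h T)) ` R3)"
    proof (rule form_power_image[OF N, where \<Psi> = "\<lambda>T. \<Phi>2 (s2 h) (\<Phi>1 (s1 g) T)"])
      fix T assume "T \<in> R3"
      then show "\<Phi>2 (s2 h) (\<Phi>1 (s1 g) T) \<in> R3"
        unfolding R3_def using comm13 comm23 by (smt (verit) mem_Collect_eq)
    qed (simp add: adj1 adj2)
    show "form_power N d ` (\<lambda>T. \<Phi>1 g (\<Phi>2 h T)) ` R3 \<subseteq> S"
      using R that unfolding R3_def R_def by blast
  qed (auto simp: I_def)
  have step1: "form_power N d (\<Phi>1 g T) \<in> S" if "g \<in> G1" for g T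
  proof (rule S_I)
    show "form_power N d (\<Phi>1 g T) \<in> fn.span (vanishing N d R2 \<union> form_power N d ` \<Phi>1 g ` R2)"
    proof (rule form_power_image[OF N adj1(2)])
      fix T assume "T \<in> R2"
      then show "\<Phi>1 (s1 g) T \<in> R2"
        unfolding R2_def using comm12 by (smt (verit) mem_Collect_eq)
    qed
    show "form_power N d ` \<Phi>1 g ` R2 \<subseteq> S"
      using step2 that unfolding R2_def by blast
  qed (auto simp: I_def)
  have "f \<in> S"
  proof (rule S_I[OF Pol_decomposition[OF N]])
    show "f \<in> Pol N d" using f by (simp add: vanishing_def)
    show "form_power N d ` R1 \<subseteq> S" using step1 unfolding R1_def by blast
  qed (auto simp: I_def)
  then obtain x y where xy: "x \<in> fn.span I" "y \<in> fn.span (form_power N d ` R)" "f = x + y"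
    unfolding S_def fn.span_Un by auto
  have "I \<subseteq> vanishing N d R"
  proof -
    \<comment> \<open>By commutativity each point of \<open>R\<close> can be written with any of its
      three maps outermost.\<close>
    have "R \<subseteq> R1" "R \<subseteq> R2" "R \<subseteq> R3"
      unfolding R_def R1_def R2_def R3_def using comm12 comm13 comm23 by (auto, metis+)
    then show ?thesis unfolding I_def vanishing_def by blast
  qed
  then have "fn.span I \<subseteq> vanishing N d R"
    by (rule fn.span_minimal) (rule subspace_vanishing)
  then have "y T = 0" if "T \<in> R" for T
    using xy(1,3) f that unfolding vanishing_def by fastforce
  then have "y = 0" using span_form_power_vanishing[OF N xy(2)] by blast
  then show ?thesis using xy by (simp add: I_def)
qed

subsection \<open>Rearrangement and splitting of monomials\<close>

definition product_sum :: "(nat \<times> nat) multiset \<Rightarrow> nat"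
  where "product_sum p = (\<Sum>x\<in>#p. fst x * snd x)"

lemma product_sum_simps [simp]:
  "product_sum {#} = 0" "product_sum (add_mset x p) = fst x * snd x + product_sum p"
  "product_sum (p + q) = product_sum p + product_sum q"
  by (simp_all add: product_sum_def)

text \<open>Compare at the member \<open>x\<close> of \<open>q\<close> with the largest coordinate
  sum. If \<open>p\<close> contains \<open>x\<close>, cancel it. Otherwise an exchange in
  \<open>p\<close> creates \<open>x\<close> and strictly increases the sum of products, after which
  \<open>x\<close> is cancelled.\<close>

lemma rearrangement:
  assumes "image_mset fst p = image_mset fst q" "image_mset snd p = image_mset snd q"
    and "\<And>x y. x \<in># q \<Longrightarrow> y \<in># q \<Longrightarrow> fst x < fst y \<Longrightarrow> snd x \<le> snd y"
  shows "product_sum p < product_sum q \<or> p = q"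
  using assms
proof (induction "size q" arbitrary: p q)
  case 0
  then show ?case by simp
next
  case (Suc k)
  define M where "M = Max ((\<lambda>x. fst x + snd x) ` set_mset q)"
  have "set_mset q \<noteq> {}" using Suc.hyps(2) by auto
  then have "M \<in> (\<lambda>x. fst x + snd x) ` set_mset q" unfolding M_def by (intro Max_in) auto
  then obtain x where x: "x \<in># q" "M = fst x + snd x" by blast
  have le: "fst y + snd y \<le> fst x + snd x" if "y \<in># q" for y
    using that unfolding x(2)[symmetric] M_def by (intro Max_ge) auto
  \<comment> \<open>A member of \<open>q\<close> exceeding \<open>x\<close> in one coordinate would,
    by the chain condition, be at least as large in the other, against the maximality of the
    sum.\<close>
  have fst_le: "fst y \<le> fst x" and snd_le: "snd y \<le> snd x" if "y \<in># q" for y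
    using le[OF that] Suc.prems(3)[OF that x(1)] Suc.prems(3)[OF x(1) that] by linarith+
  obtain R C where RC: "x = (R, C)" by fastforce
  obtain q' where q': "q = add_mset x q'" using x(1) by (metis insert_DiffM)
  have chain': "snd x \<le> snd y" if "x \<in># q'" "y \<in># q'" "fst x < fst y" for x y
    using Suc.prems(3) that by (auto simp: q')
  have size': "k = size q'" using Suc.hyps(2) by (simp add: q')
  have "R \<in># image_mset fst p" unfolding Suc.prems(1) by (simp add: q' RC)
  then obtain b where b: "(R, b) \<in># p" by auto
  have "C \<in># image_mset snd p" unfolding Suc.prems(2) by (simp add: q' RC)
  then obtain a where a: "(a, C) \<in># p" by auto
  have "a \<in># image_mset fst q" unfolding Suc.prems(1)[symmetric] using a by force
  then have aR: "a \<le> R" using fst_le RC by auto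
  have "b \<in># image_mset snd q" unfolding Suc.prems(2)[symmetric] using b by force
  then have bC: "b \<le> C" using snd_le RC by auto
  show ?case
  proof (cases "(R, C) \<in># p")
    case True
    then obtain p' where p': "p = add_mset x p'" unfolding RC by (metis insert_DiffM)
    have "product_sum p' < product_sum q' \<or> p' = q'"
      by (rule Suc.hyps(1)[OF size' _ _ chain']) (use Suc.prems(1,2) in \<open>auto simp: p' q'\<close>)
    then show ?thesis by (auto simp: p' q')
  next
    \<comment> \<open>The coordinates of \<open>x\<close> occur in \<open>p\<close> in two different
      members \<open>(R, b)\<close> and \<open>(a, C)\<close>; they are exchanged for
      \<open>(R, C)\<close> and \<open>(a, b)\<close>.\<close>
    case False
    then have "a \<noteq> R" "b \<noteq> C" using a b by auto
    then obtain u v where uv: "R = a + Suc u" "C = b + Suc v"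
      using aR bC less_imp_Suc_add[of a R] less_imp_Suc_add[of b C] by auto
    obtain p1 where p1: "p = add_mset (R, b) p1" using b by (metis insert_DiffM)
    have "(a, C) \<in># p1" using a \<open>a \<noteq> R\<close> by (auto simp: p1)
    then obtain p2 where p2: "p1 = add_mset (a, C) p2" by (metis insert_DiffM)
    have "image_mset fst (add_mset (a, b) p2) = image_mset fst q'"
         "image_mset snd (add_mset (a, b) p2) = image_mset snd q'"
      using Suc.prems(1,2) by (auto simp: p1 p2 q' RC add_mset_commute[of _ R] add_mset_commute[of _ C])
    from Suc.hyps(1)[OF size' this chain'] have "a * b + product_sum p2 \<le> product_sum q'" by auto
    moreover have "R * b + a * C < R * C + a * b"
      unfolding uv by (simp add: algebra_simps)
    ultimately show ?thesis by (simp add: p1 p2 q' RC)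
  qed
qed

text \<open>The expansion runs over sets \<open>B\<close> of positions in a word, which keeps
  repeated factors of the monomial apart.\<close>

lemma mon_add_expand:
  "mon (mset w) (\<lambda>n. f n + g n) =
    (\<Sum>B\<in>Pow {..<length w}. mon (image_mset (nth w) (mset_set B)) f
      * mon (image_mset (nth w) (mset_set ({..<length w} - B))) g)"
proof -
  have "mon (mset w) T = (\<Prod>i<length w. T (w ! i))" for T :: "'a \<Rightarrow> complex"
  proof -
    have "mon (mset w) T = prod_list (map T w)" by (simp add: mon_def flip: mset_map prod_mset_prod_list)
    also have "\<dots> = (\<Prod>i<length w. T (w ! i))"
      by (simp add: prod.list_conv_set_nth lessThan_atLeast0)
    finally show ?thesis .
  qed
  then have "mon (mset w) (\<lambda>n. f n + g n) = (\<Prod>i<length w. f (w ! i) + g (w ! i))" by simp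
  also have "\<dots> = (\<Sum>B\<in>Pow {..<length w}. (\<Prod>i\<in>B. f (w ! i)) * (\<Prod>i\<in>{..<length w} - B. g (w ! i)))"
    by (rule prod_add) simp
  also have "\<dots> = (\<Sum>B\<in>Pow {..<length w}. mon (image_mset (nth w) (mset_set B)) f
      * mon (image_mset (nth w) (mset_set ({..<length w} - B))) g)"
    by (simp add: mon_image_mset) (simp add: mon_def prod_unfold_prod_mset)
  finally show ?thesis .
qed

lemma index_split_filter:
  "image_mset (nth w) (mset_set {i. i < length w \<and> P (w ! i)}) = filter_mset P (mset w)"
proof -
  have w: "image_mset (nth w) (mset_set {..<length w}) = mset w"
    by (simp add: lessThan_atLeast0 map_nth flip: mset_upt mset_map)
  have "filter_mset P (image_mset f M) = image_mset f (filter_mset (\<lambda>i. P (f i)) M)"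
    for M :: "nat multiset" and f
    by (induction M) auto
  from this[of "nth w" "mset_set {..<length w}"] show ?thesis
    unfolding w by (simp add: filter_mset_mset_set)
qed

subsection \<open>Straightening modulo the minors of a flattening\<close>

definition det3 :: "('i \<Rightarrow> 'j \<Rightarrow> complex) \<Rightarrow> 'i \<Rightarrow> 'i \<Rightarrow> 'i \<Rightarrow> 'j \<Rightarrow> 'j \<Rightarrow> 'j \<Rightarrow> complex"
  where "det3 x i1 i2 i3 j1 j2 j3 =
    x i1 j1 * x i2 j2 * x i3 j3 - x i1 j1 * x i2 j3 * x i3 j2 - x i1 j2 * x i2 j1 * x i3 j3
    + x i1 j2 * x i2 j3 * x i3 j1 + x i1 j3 * x i2 j1 * x i3 j2 - x i1 j3 * x i2 j2 * x i3 j1"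

text \<open>
  A flattening of the index set \<open>N\<close> into a matrix: \<open>\<rho> n\<close> is the row of \<open>n\<close>, and \<open>upd i n\<close> is the
  entry of row \<open>i\<close> in the column of \<open>n\<close>.
\<close>
locale flattening =
  fixes N :: "'n set" and A :: "'r set" and \<rho> :: "'n \<Rightarrow> 'r" and upd :: "'r \<Rightarrow> 'n \<Rightarrow> 'n"
  assumes finite_N: "finite N" and finite_A: "finite A"
    and row_in: "n \<in> N \<Longrightarrow> \<rho> n \<in> A"
    and upd_in: "i \<in> A \<Longrightarrow> n \<in> N \<Longrightarrow> upd i n \<in> N"
    and row_upd [simp]: "\<rho> (upd i n) = i"
    and upd_upd [simp]: "upd i (upd j n) = upd i n"
    and upd_row [simp]: "upd (\<rho> n) n = n"
begin

text \<open>Columns have no type of their own: each is named by any one of its entries, so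
  \<open>n1\<close>, \<open>n2\<close>, \<open>n3\<close> matter only through their columns.\<close>

definition minor :: "'r \<Rightarrow> 'r \<Rightarrow> 'r \<Rightarrow> 'n \<Rightarrow> 'n \<Rightarrow> 'n \<Rightarrow> ('n \<Rightarrow> complex) \<Rightarrow> complex"
  where "minor i1 i2 i3 n1 n2 n3 T = det3 (\<lambda>i n. T (upd i n)) i1 i2 i3 n1 n2 n3"

end

text \<open>The numbers order the rows and the columns, and the choice of standard monomials depends
  on these orders. \<open>c_inj\<close> says that entries of \<open>N\<close> with equal column
  number lie in one column.\<close>

locale numbered_flattening = flattening N A \<rho> upd
  for N :: "'n set" and A :: "'r set" and \<rho> :: "'n \<Rightarrow> 'r" and upd :: "'r \<Rightarrow> 'n \<Rightarrow> 'n" +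
  fixes r :: "'r \<Rightarrow> nat" and c :: "'n \<Rightarrow> nat"
  assumes r_inj: "inj_on r A"
    and c_upd: "c (upd i n) = c n"
    and c_inj: "n \<in> N \<Longrightarrow> n' \<in> N \<Longrightarrow> c n = c n' \<Longrightarrow> upd (\<rho> n) n' = n"
begin

definition pos :: "'n \<Rightarrow> nat \<times> nat"
  where "pos n = (r (\<rho> n), c n)"

lemma inj_pos: "inj_on pos N"
proof (rule inj_onI)
  fix n n' assume *: "n \<in> N" "n' \<in> N" "pos n = pos n'"
  then have "\<rho> n = \<rho> n'" using r_inj row_in by (auto simp: pos_def dest: inj_onD)
  moreover have "upd (\<rho> n) n' = n" using * c_inj by (simp add: pos_def)
  ultimately show "n = n'" by simp
qed

definition weight :: "'n multiset \<Rightarrow> nat"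
  where "weight m = product_sum (image_mset pos m)"

text \<open>Three such factors form the antidiagonal term of a 3x3 minor, so these are the monomials
  divisible by no such term.\<close>

definition standard :: "'n multiset \<Rightarrow> bool"
  where "standard m \<longleftrightarrow> \<not> (\<exists>n1\<in>#m. \<exists>n2\<in>#m. \<exists>n3\<in>#m.
    r (\<rho> n1) < r (\<rho> n2) \<and> r (\<rho> n2) < r (\<rho> n3) \<and> c n1 > c n2 \<and> c n2 > c n3)"

definition std_monomials :: "nat \<Rightarrow> 'n multiset set"
  where "std_monomials d = {m. size m = d \<and> set_mset m \<subseteq> N \<and> standard m}"

lemma finite_std_monomials: "finite (std_monomials d)"
  by (rule finite_subset[OF _ finite_msets[OF finite_N, of d]]) (auto simp: std_monomials_def)

text \<open>Modulo a minor, its antidiagonal term is a combination of the five other terms of the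
  determinant, each of which has larger weight. The weight is bounded in degree \<open>d\<close>, so
  the replacement terminates. \<open>D\<close> will be the ideal of minors.\<close>

lemma straighten:
  assumes D: "fn.subspace D"
    and D_mult: "\<And>f n. f \<in> D \<Longrightarrow> n \<in> N \<Longrightarrow> (\<lambda>T. T n * f T) \<in> D"
    and D_minor: "\<And>i1 i2 i3 n1 n2 n3. {i1, i2, i3} \<subseteq> A \<Longrightarrow> {n1, n2, n3} \<subseteq> N \<Longrightarrow> minor i1 i2 i3 n1 n2 n3 \<in> D"
    and m: "size m = d" "set_mset m \<subseteq> N"
  shows "mon m \<in> fn.span (D \<union> mon ` std_monomials d)"
proof -
  \<comment> \<open>\<open>b\<close> bounds the weight of a single factor, hence
    \<open>d * b\<close> that of a monomial of degree \<open>d\<close>.\<close>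
  define b where "b = Max (insert 0 ((\<lambda>n. fst (pos n) * snd (pos n)) ` N))"
  have b: "fst (pos n) * snd (pos n) \<le> b" if "n \<in> N" for n
    unfolding b_def using that finite_N by (intro Max_ge) auto
  have bound: "weight m \<le> d * b" if "size m = d" "set_mset m \<subseteq> N" for m
    using that
  proof (induction m arbitrary: d)
    case (add n m)
    then have "weight m \<le> size m * b" by simp
    then show ?case using add.prems b[of n] by (auto simp: weight_def)
  qed (simp add: weight_def)
  show ?thesis using m
  proof (induction "d * b - weight m" arbitrary: m rule: less_induct)
    case less
    show ?case
    proof (cases "standard m")
      case True
      then show ?thesis using less.prems by (auto simp: std_monomials_def intro: fn.span_base)
    next
      case False
      then obtain n1 n2 n3 where n: "n1 \<in># m" "n2 \<in># m" "n3 \<in># m"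
        and rr: "r (\<rho> n1) < r (\<rho> n2)" "r (\<rho> n2) < r (\<rho> n3)" and cc: "c n1 > c n2" "c n2 > c n3"
        by (auto simp: standard_def)
      obtain m1 where m1: "m = add_mset n1 m1" using n(1) by (metis insert_DiffM)
      have "n2 \<in># m1" using n(2) rr by (auto simp: m1)
      then obtain m2 where m2: "m1 = add_mset n2 m2" by (metis insert_DiffM)
      have "n3 \<in># m2" using n(3) rr by (auto simp: m1 m2)
      then obtain m3 where m3: "m2 = add_mset n3 m3" by (metis insert_DiffM)
      have nN: "n1 \<in> N" "n2 \<in> N" "n3 \<in> N" and m3N: "set_mset m3 \<subseteq> N"
        using less.prems by (auto simp: m1 m2 m3)
      have d: "d = size m3 + 3" using less.prems by (auto simp: m1 m2 m3)
      define i1 i2 i3 where "i1 = \<rho> n1" and "i2 = \<rho> n2" and "i3 = \<rho> n3"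
      have iA: "i1 \<in> A" "i2 \<in> A" "i3 \<in> A" by (simp_all add: i1_def i2_def i3_def row_in nN)
      \<comment> \<open>\<open>m\<close> with its antidiagonal replaced by entries in the same rows
        and in the columns of \<open>j1\<close>, \<open>j2\<close>, \<open>j3\<close>.\<close>
      define X where "X j1 j2 j3 = mon (m3 + {#upd i1 j1, upd i2 j2, upd i3 j3#})" for j1 j2 j3
      have mX: "mon m = X n1 n2 n3"
        by (rule ext) (simp add: X_def m1 m2 m3 i1_def i2_def i3_def)
      have IH: "X j1 j2 j3 \<in> fn.span (D \<union> mon ` std_monomials d)"
        if "j1 \<in> N" "j2 \<in> N" "j3 \<in> N"
          "r i1 * c n1 + r i2 * c n2 + r i3 * c n3 < r i1 * c j1 + r i2 * c j2 + r i3 * c j3" for j1 j2 j3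
        unfolding X_def
      proof (rule less.hyps)
        show *: "size (m3 + {#upd i1 j1, upd i2 j2, upd i3 j3#}) = d" by (simp add: d)
        show **: "set_mset (m3 + {#upd i1 j1, upd i2 j2, upd i3 j3#}) \<subseteq> N"
          using m3N iA that upd_in by auto
        have "weight m < weight (m3 + {#upd i1 j1, upd i2 j2, upd i3 j3#})"
          using that iA by (simp add: m1 m2 m3 weight_def pos_def c_upd i1_def[symmetric] i2_def[symmetric] i3_def[symmetric])
        then show "d * b - weight (m3 + {#upd i1 j1, upd i2 j2, upd i3 j3#}) < d * b - weight m"
          using bound[OF * **] by linarith
      qed
      \<comment> \<open>Naming the differences turns the five weight inequalities into comparisons
        of natural number polynomials that simplification decides.\<close>
      obtain x y where r23: "r i2 = r i1 + Suc x" "r i3 = r i1 + Suc x + Suc y"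
        using rr less_imp_Suc_add by (metis add_Suc_right i1_def i2_def i3_def)
      obtain u v where c12: "c n2 = c n3 + Suc u" "c n1 = c n3 + Suc u + Suc v"
        using cc less_imp_Suc_add by (metis add_Suc_right)
      have five: "X n1 n3 n2 \<in> fn.span (D \<union> mon ` std_monomials d)"
        "X n2 n1 n3 \<in> fn.span (D \<union> mon ` std_monomials d)"
        "X n2 n3 n1 \<in> fn.span (D \<union> mon ` std_monomials d)"
        "X n3 n1 n2 \<in> fn.span (D \<union> mon ` std_monomials d)"
        "X n3 n2 n1 \<in> fn.span (D \<union> mon ` std_monomials d)"
        by (rule IH; use nN in \<open>simp add: r23 c12 algebra_simps\<close>)+
      have mult: "(\<lambda>T. mon p T * f T) \<in> D" if "f \<in> D" "set_mset p \<subseteq> N" for p f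
        using that
      proof (induction p)
        case (add n p)
        then have "(\<lambda>T. T n * (mon p T * f T)) \<in> D" by (intro D_mult) auto
        then show ?case by (simp add: mult.assoc)
      qed simp
      have "(\<lambda>T. mon m3 T * minor i1 i2 i3 n1 n2 n3 T) \<in> D"
        by (rule mult[OF D_minor]) (use iA nN m3N in auto)
      then have minor: "(\<lambda>T. mon m3 T * minor i1 i2 i3 n1 n2 n3 T) \<in> fn.span (D \<union> mon ` std_monomials d)"
        by (simp add: fn.span_base)
      \<comment> \<open>The columns are listed in decreasing order, so the antidiagonal of the
        matrix is the first product in \<open>det3\<close>, with sign plus.\<close>
      have "mon m = (\<lambda>T. mon m3 T * minor i1 i2 i3 n1 n2 n3 T)
        + X n1 n3 n2 + X n2 n1 n3 - X n2 n3 n1 - X n3 n1 n2 + X n3 n2 n1"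
        unfolding mX by (rule ext) (simp add: X_def minor_def det3_def algebra_simps)
      also have "\<dots> \<in> fn.span (D \<union> mon ` std_monomials d)"
        by (intro fn.span_add fn.span_diff five minor)
      finally show ?thesis .
    qed
  qed
qed

text \<open>Take \<open>m0\<close> of least weight among the monomials with nonzero coefficient and
  split it into chains \<open>p0\<close> and \<open>q0\<close>. After expansion, the product of the
  variables \<open>s\<close>, \<open>y\<close> over \<open>p0\<close> and \<open>t\<close>,
  \<open>z\<close> over \<open>q0\<close> arises, by rearrangement, only from \<open>m0\<close> or
  from monomials of smaller weight. So its coefficient is a positive multiple of
  \<open>\<gamma> m0\<close>.\<close>

lemma standard_independent:
  assumes zero: "\<And>s y t z. (\<Sum>m\<in>std_monomials d. \<gamma> m * mon m (\<lambda>n. s (r (\<rho> n)) * y (c n) + t (r (\<rho> n)) * z (c n))) = 0"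
    and m: "m \<in> std_monomials d"
  shows "\<gamma> m = 0"
proof (rule ccontr)
  assume "\<gamma> m \<noteq> 0"
  define S where "S = {m \<in> std_monomials d. \<gamma> m \<noteq> 0}"
  have "S \<noteq> {}" "finite S" using m \<open>\<gamma> m \<noteq> 0\<close> finite_std_monomials by (auto simp: S_def)
  then obtain m0 where m0: "m0 \<in> S" "\<And>m. m \<in> S \<Longrightarrow> weight m0 \<le> weight m"
    using arg_min_if_finite[of S weight] by (metis not_less)
  have m0': "size m0 = d" "set_mset m0 \<subseteq> N" "standard m0" "m0 \<in> std_monomials d" "\<gamma> m0 \<noteq> 0"
    using m0(1) by (auto simp: S_def std_monomials_def)
  define w where "w m = (SOME w. mset w = m)" for m :: "'n multiset"
  have w: "mset (w m) = m" for m unfolding w_def by (rule someI_ex) (rule ex_mset)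
  have len: "length (w m) = d" if "m \<in> std_monomials d" for m
    using w[of m] that by (metis (mono_tags) mem_Collect_eq size_mset std_monomials_def)
  \<comment> \<open>A term of the expansion is given by a monomial and the set of positions in its
    word where the summand with \<open>s\<close> and \<open>y\<close> is chosen. \<open>P\<close>
    collects the factors at these positions and \<open>Q\<close> the others.\<close>
  define J where "J = (SIGMA m:std_monomials d. Pow {..<d})"
  define P where "P = (\<lambda>(m, B). image_mset (nth (w m)) (mset_set B))"
  define Q where "Q = (\<lambda>(m, B). image_mset (nth (w m)) (mset_set ({..<d} - B)))"
  \<comment> \<open>The variables \<open>s\<close>, \<open>y\<close>, \<open>t\<close>, \<open>z\<close> are the pairs with first component 0, 1, 2, 3.\<close>
  define margins :: "'n multiset \<Rightarrow> 'n multiset \<Rightarrow> (nat \<times> nat) multiset"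
    where "margins p q = image_mset (\<lambda>n. (0, r (\<rho> n))) p + image_mset (\<lambda>n. (1, c n)) p
      + image_mset (\<lambda>n. (2, r (\<rho> n))) q + image_mset (\<lambda>n. (3, c n)) q" for p q
  \<comment> \<open>These factors begin a strict antidiagonal of length 2 in \<open>m0\<close>. No
    two of them form such an antidiagonal, as it would extend to length 3; no two of the others do
    either, as the first would then be among these.\<close>
  define tops where "tops n \<longleftrightarrow> (\<exists>n'\<in>#m0. r (\<rho> n) < r (\<rho> n') \<and> c n > c n')" for n
  define p0 where "p0 = filter_mset tops m0"
  define q0 where "q0 = filter_mset (\<lambda>n. \<not> tops n) m0"
  have pq0: "m0 = p0 + q0" by (simp add: p0_def q0_def)
  have PQ: "fst j = P j + Q j" "set_mset (P j) \<subseteq> N" "set_mset (Q j) \<subseteq> N" if "j \<in> J" for j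
  proof -
    obtain m B where j: "j = (m, B)" "m \<in> std_monomials d" "B \<subseteq> {..<d}"
      using \<open>j \<in> J\<close> by (auto simp: J_def)
    have "mset_set {..<d} = mset_set (B \<union> ({..<d} - B))" by (rule arg_cong) (use j in auto)
    also have "\<dots> = mset_set B + mset_set ({..<d} - B)"
      by (rule mset_set_Union) (use j finite_subset in auto)
    finally have "P j + Q j = image_mset (nth (w m)) (mset_set {..<d})"
      by (simp add: P_def Q_def j)
    also have "\<dots> = m"
      using index_split_filter[of "w m" "\<lambda>_. True"] len[OF j(2)] w[of m] by (simp add: lessThan_def)
    finally show "fst j = P j + Q j" by (simp add: j)
    moreover have "set_mset m \<subseteq> N" using j by (simp add: std_monomials_def)
    ultimately show "set_mset (P j) \<subseteq> N" "set_mset (Q j) \<subseteq> N"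
      by (metis Un_subset_iff fst_conv j(1) set_mset_union)+
  qed

  \<comment> \<open>Selecting by the first component recovers each of the four kinds of variable
    from \<open>margins\<close>.\<close>
  have sel: "image_mset snd {#x \<in># image_mset (\<lambda>n. (k, g n)) p. fst x = i#} = (if i = k then image_mset g p else {#})"
    for i k :: nat and g :: "'n \<Rightarrow> nat" and p by (induction p) auto
  have margins_inj: "image_mset fst (image_mset pos p) = image_mset fst (image_mset pos p')"
    "image_mset snd (image_mset pos p) = image_mset snd (image_mset pos p')"
    "image_mset fst (image_mset pos q) = image_mset fst (image_mset pos q')"
    "image_mset snd (image_mset pos q) = image_mset snd (image_mset pos q')"
    if "margins p q = margins p' q'" for p q p' q'
  proof -
    have *: "image_mset snd {#x \<in># margins p q. fst x = i#} = image_mset snd {#x \<in># margins p' q'. fst x = i#}" for i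
      by (simp add: that)
    show "image_mset fst (image_mset pos p) = image_mset fst (image_mset pos p')"
      using *[of 0] by (simp add: margins_def sel multiset.map_comp comp_def pos_def)
    show "image_mset snd (image_mset pos p) = image_mset snd (image_mset pos p')"
      using *[of 1] by (simp add: margins_def sel[where i = "Suc 0"] sel multiset.map_comp comp_def pos_def)
    show "image_mset fst (image_mset pos q) = image_mset fst (image_mset pos q')"
      using *[of 2] by (simp add: margins_def sel multiset.map_comp comp_def pos_def)
    show "image_mset snd (image_mset pos q) = image_mset snd (image_mset pos q')"
      using *[of 3] by (simp add: margins_def sel multiset.map_comp comp_def pos_def)
  qed
  have chain_p: "snd x \<le> snd y" if "x \<in># image_mset pos p0" "y \<in># image_mset pos p0" "fst x < fst y" for x y
  proof (rule ccontr)
    assume "\<not> snd x \<le> snd y"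
    with that obtain n n' where "n \<in># m0" "n' \<in># m0" "tops n'" "r (\<rho> n) < r (\<rho> n')" "c n > c n'"
      by (auto simp: p0_def pos_def)
    then show False using m0'(3) unfolding standard_def tops_def by blast
  qed
  have chain_q: "snd x \<le> snd y" if "x \<in># image_mset pos q0" "y \<in># image_mset pos q0" "fst x < fst y" for x y
    using that by (auto simp: q0_def pos_def tops_def)
  have unique: "m = m0" if j: "(m, B) \<in> J" "margins (P (m, B)) (Q (m, B)) = margins p0 q0" "\<gamma> m \<noteq> 0" for m B
  proof -
    let ?p = "P (m, B)" and ?q = "Q (m, B)"
    note mi = margins_inj[OF j(2)]
    have p: "product_sum (image_mset pos ?p) < product_sum (image_mset pos p0) \<or> image_mset pos ?p = image_mset pos p0"
      by (rule rearrangement[OF mi(1,2) chain_p])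
    have q: "product_sum (image_mset pos ?q) < product_sum (image_mset pos q0) \<or> image_mset pos ?q = image_mset pos q0"
      by (rule rearrangement[OF mi(3,4) chain_q])
    have m: "m = ?p + ?q" using PQ(1)[OF j(1)] by simp
    have "m \<in> S" using j by (auto simp: S_def J_def)
    then have "weight m0 \<le> weight m" by (rule m0(2))
    moreover have "weight m = product_sum (image_mset pos ?p) + product_sum (image_mset pos ?q)"
      unfolding weight_def by (subst m) simp
    moreover have "weight m0 = product_sum (image_mset pos p0) + product_sum (image_mset pos q0)"
      unfolding weight_def by (subst pq0) simp
    ultimately have "image_mset pos ?p = image_mset pos p0" "image_mset pos ?q = image_mset pos q0"
      using p q by auto
    then have "image_mset pos m = image_mset pos m0" 
      by (metis m pq0 image_mset_union)
    moreover have "image_mset (inv_into N pos) (image_mset pos m') = m'" if "set_mset m' \<subseteq> N" for m'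
      unfolding multiset.map_comp
      by (rule multiset.map_ident_strong) (use that in \<open>auto simp: inv_into_f_f[OF inj_pos]\<close>)
    moreover have "set_mset m \<subseteq> N" using \<open>m \<in> S\<close> by (auto simp: S_def std_monomials_def)
    ultimately show "m = m0"
      using m0'(2) by metis
  qed
  have sum0: "(\<Sum>j | j \<in> J \<and> margins (P j) (Q j) = margins p0 q0. \<gamma> (fst j)) = 0"
  proof (rule mon_independent)
    show "finite J" unfolding J_def using finite_std_monomials by auto
    show "finite (\<Union>n\<in>N. {(0, r (\<rho> n)), (1, c n), (2, r (\<rho> n)), (3::nat, c n)})" using finite_N by auto
    show "set_mset (margins (P j) (Q j)) \<subseteq> (\<Union>n\<in>N. {(0, r (\<rho> n)), (1, c n), (2, r (\<rho> n)), (3, c n)})" if "j \<in> J" for j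
      using PQ(2,3)[OF that] unfolding margins_def by auto
    fix x :: "nat \<times> nat \<Rightarrow> complex"
    have prod: "mon p (\<lambda>n. f n * g n) = mon p f * mon p g" for p :: "'n multiset" and f g
      by (induction p) auto
    have "(\<Sum>j\<in>J. \<gamma> (fst j) * mon (margins (P j) (Q j)) x)
      = (\<Sum>m\<in>std_monomials d. \<gamma> m * (\<Sum>B\<in>Pow {..<d}. mon (margins (P (m, B)) (Q (m, B))) x))"
      unfolding J_def by (simp add: sum_distrib_left sum.cartesian_product split_def)
    also have "\<dots> = (\<Sum>m\<in>std_monomials d. \<gamma> m * mon m (\<lambda>n. x (0, r (\<rho> n)) * x (1, c n) + x (2, r (\<rho> n)) * x (3, c n)))"
    proof (intro sum.cong refl arg_cong2[where f = "(*)"])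
      fix m assume "m \<in> std_monomials d"
      then show "(\<Sum>B\<in>Pow {..<d}. mon (margins (P (m, B)) (Q (m, B))) x)
        = mon m (\<lambda>n. x (0, r (\<rho> n)) * x (1, c n) + x (2, r (\<rho> n)) * x (3, c n))"
        using mon_add_expand[of "w m" "\<lambda>n. x (0, r (\<rho> n)) * x (1, c n)" "\<lambda>n. x (2, r (\<rho> n)) * x (3, c n)"]
        by (simp add: w len margins_def P_def Q_def mon_image_mset prod mult.assoc)
    qed
    also have "\<dots> = 0"
      using zero[of "\<lambda>i. x (0, i)" "\<lambda>i. x (1, i)" "\<lambda>i. x (2, i)" "\<lambda>i. x (3, i)"] .
    finally show "(\<Sum>j\<in>J. \<gamma> (fst j) * mon (margins (P j) (Q j)) x) = 0" .
  qed
  define X where "X = {j \<in> J. margins (P j) (Q j) = margins p0 q0}"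
  have finX: "finite X" unfolding X_def J_def using finite_std_monomials by auto
  \<comment> \<open>The choice of positions that splits \<open>m0\<close> into \<open>p0\<close> and
    \<open>q0\<close>; it shows that \<open>m0\<close> occurs at least once in the sum.\<close>
  define B0 where "B0 = {i. i < d \<and> tops (w m0 ! i)}"
  have "{..<d} - B0 = {i. i < d \<and> \<not> tops (w m0 ! i)}" by (auto simp: B0_def)
  then have "P (m0, B0) = p0" "Q (m0, B0) = q0"
    using index_split_filter[of "w m0" tops] index_split_filter[of "w m0" "\<lambda>n. \<not> tops n"] len[OF m0'(4)]
    by (simp_all add: P_def Q_def B0_def p0_def q0_def w)
  then have "(m0, B0) \<in> X" using m0'(4) by (auto simp: X_def J_def B0_def)
  then have card: "card {j \<in> X. fst j = m0} \<noteq> 0" using finX by auto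
  have "(\<Sum>j\<in>X. \<gamma> (fst j)) = (\<Sum>j\<in>X. if fst j = m0 then \<gamma> m0 else 0)"
  proof (rule sum.cong)
    fix j assume "j \<in> X"
    then show "\<gamma> (fst j) = (if fst j = m0 then \<gamma> m0 else 0)"
      using unique[of "fst j" "snd j"] by (auto simp: X_def)
  qed simp
  also have "\<dots> = of_nat (card {j \<in> X. fst j = m0}) * \<gamma> m0"
    using finX by (simp add: sum.If_cases Collect_conj_eq)
  finally show False using sum0 card m0'(5) by (simp add: X_def)
qed

end

section \<open>Matrices of rank at most two acting on the rows\<close>

definition rank_two_matrices :: "('r \<Rightarrow> 'r \<Rightarrow> complex) set"
  where "rank_two_matrices = {g. \<exists>s t y z. g = (\<lambda>i j. s i * y j + t i * z j)}"

definition adjoint :: "('r \<Rightarrow> 'r \<Rightarrow> complex) \<Rightarrow> 'r \<Rightarrow> 'r \<Rightarrow> complex"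
  where "adjoint g i j = cnj (g j i)"

lemma adjoint_rank_two:
  assumes "g \<in> rank_two_matrices"
  shows "adjoint g \<in> rank_two_matrices"
proof -
  obtain s t y z where "g = (\<lambda>i j. s i * y j + t i * z j)"
    using assms by (auto simp: rank_two_matrices_def)
  then have "adjoint g = (\<lambda>i j. cnj (y i) * cnj (s j) + cnj (z i) * cnj (t j))"
    by (auto simp: adjoint_def fun_eq_iff)
  then show ?thesis
    unfolding rank_two_matrices_def
    by (intro CollectI exI[of _ "\<lambda>i. cnj (y i)"] exI[of _ "\<lambda>i. cnj (s i)"]
        exI[of _ "\<lambda>i. cnj (z i)"] exI[of _ "\<lambda>i. cnj (t i)"])
qed

context flattening
begin

text \<open>Left multiplication of the flattened matrix by \<open>g\<close>, that is, an
  endomorphism applied to one tensor factor.\<close>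

definition act :: "('r \<Rightarrow> 'r \<Rightarrow> complex) \<Rightarrow> ('n \<Rightarrow> complex) \<Rightarrow> 'n \<Rightarrow> complex"
  where "act g T n = (\<Sum>i\<in>A. g (\<rho> n) i * T (upd i n))"

lemma act_adjoint:
  "(\<Sum>n\<in>N. T n * cnj (act g v n)) = (\<Sum>n\<in>N. act (adjoint g) T n * cnj (v n))"
proof -
  have "(\<Sum>n\<in>N. T n * cnj (act g v n)) = (\<Sum>(n, i)\<in>N \<times> A. T n * cnj (g (\<rho> n) i) * cnj (v (upd i n)))"
    by (simp add: act_def sum_distrib_left sum.cartesian_product mult.assoc)
  also have "\<dots> = (\<Sum>(n, i)\<in>N \<times> A. cnj (g i (\<rho> n)) * T (upd i n) * cnj (v n))"
    \<comment> \<open>The reindexing exchanges an entry with the entry of row \<open>i\<close> in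
      its column and is its own inverse.\<close>
    by (rule sum.reindex_bij_witness[of _ "\<lambda>(n, i). (upd i n, \<rho> n)" "\<lambda>(n, i). (upd i n, \<rho> n)"])
      (auto simp: row_in upd_in)
  also have "\<dots> = (\<Sum>n\<in>N. act (adjoint g) T n * cnj (v n))"
    by (simp add: act_def adjoint_def sum_distrib_right sum.cartesian_product)
  finally show ?thesis .
qed

text \<open>Sums of two outer products. A function of the column is encoded as a function of the
  entry that is constant along columns.\<close>

definition rank_two :: "('n \<Rightarrow> complex) set"
  where "rank_two = {\<lambda>n. s (\<rho> n) * y n + t (\<rho> n) * z n | s t y z.
    \<forall>i n. y (upd i n) = y n \<and> z (upd i n) = z n}"

definition minor_ideal :: "(('n \<Rightarrow> complex) \<Rightarrow> complex) set"
  where "minor_ideal = fn.span {\<lambda>T. mon p T * minor i1 i2 i3 n1 n2 n3 T | p i1 i2 i3 n1 n2 n3.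
    set_mset p \<subseteq> N \<and> {i1, i2, i3} \<subseteq> A \<and> {n1, n2, n3} \<subseteq> N}"

lemma minor_ideal_base:
  "set_mset p \<subseteq> N \<Longrightarrow> {i1, i2, i3} \<subseteq> A \<Longrightarrow> {n1, n2, n3} \<subseteq> N \<Longrightarrow>
    (\<lambda>T. mon p T * minor i1 i2 i3 n1 n2 n3 T) \<in> minor_ideal"
  unfolding minor_ideal_def by (rule fn.span_base) blast

lemma minor_rank_two: "T \<in> rank_two \<Longrightarrow> minor i1 i2 i3 n1 n2 n3 T = 0"
  by (auto simp: rank_two_def minor_def det3_def algebra_simps)

lemma minor_ideal_rank_two:
  assumes "f \<in> minor_ideal" "T \<in> rank_two"
  shows "f T = 0"
  using assms(1) unfolding minor_ideal_def
  by (induction rule: fn.span_induct_alt) (auto simp: minor_rank_two[OF assms(2)])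

lemma minor_ideal_mult:
  assumes "f \<in> minor_ideal" "n \<in> N"
  shows "(\<lambda>T. T n * f T) \<in> minor_ideal"
  using assms(1) unfolding minor_ideal_def
proof (induction rule: fn.span_induct_alt)
  case base
  then show ?case using fn.span_zero by (simp add: zero_fun_def)
next
  case (step k x y)
  then obtain p i1 i2 i3 n1 n2 n3 where x: "x = (\<lambda>T. mon p T * minor i1 i2 i3 n1 n2 n3 T)"
    "set_mset p \<subseteq> N" "{i1, i2, i3} \<subseteq> A" "{n1, n2, n3} \<subseteq> N" by auto
  have "(\<lambda>T. mon (add_mset n p) T * minor i1 i2 i3 n1 n2 n3 T) \<in> minor_ideal"
    by (rule minor_ideal_base) (use x(2-4) assms(2) in auto)
  from fn.span_add[OF fn.span_scale[OF this[unfolded minor_ideal_def], of k] step.IH]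
  show ?case by (simp add: x(1) plus_fun_def algebra_simps)
qed

text \<open>A column is numbered by its entry in a fixed row \<open>a\<close>, through an injective
  numbering of \<open>N\<close>.\<close>

lemma exists_numbering: "\<exists>r c. numbered_flattening N A \<rho> upd r c"
proof -
  obtain r :: "'r \<Rightarrow> nat" where r: "inj_on r A"
    using finite_imp_inj_to_nat_seg[OF finite_A] by blast
  obtain g :: "'n \<Rightarrow> nat" where g: "inj_on g N"
    using finite_imp_inj_to_nat_seg[OF finite_N] by blast
  \<comment> \<open>If \<open>A\<close> is empty then \<open>a\<close> is arbitrary, but
    \<open>N\<close> is empty too.\<close>
  define a where "a = (SOME a. a \<in> A)"
  have a: "a \<in> A" if "n \<in> N" for n using row_in[OF that] unfolding a_def by (metis someI)
  have "numbered_flattening N A \<rho> upd r (\<lambda>n. g (upd a n))"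
  proof
    fix n n' assume n: "n \<in> N" "n' \<in> N" "g (upd a n) = g (upd a n')"
    then have "upd a n = upd a n'"
      using inj_onD[OF g] upd_in[OF a] by blast
    then have "upd (\<rho> n) (upd a n) = upd (\<rho> n) (upd a n')" by simp
    then show "upd (\<rho> n) n' = n" by simp
  qed (use r in auto)
  then show ?thesis by blast
qed

text \<open>Straightening writes a form as a member of the ideal plus a combination of standard
  monomials. If the form vanishes on \<open>rank_two\<close>, so does that combination, and
  independence makes it zero.\<close>

lemma vanishing_rank_two_subset_minor_ideal:
  "vanishing N d rank_two \<subseteq> minor_ideal"
proof
  fix f assume f: "f \<in> vanishing N d rank_two"
  obtain r c where "numbered_flattening N A \<rho> upd r c" using exists_numbering by blast
  then interpret numbered_flattening N A \<rho> upd r c .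
  have sub: "fn.subspace minor_ideal" by (simp add: minor_ideal_def)
  have minor: "minor i1 i2 i3 n1 n2 n3 \<in> minor_ideal"
    if "{i1, i2, i3} \<subseteq> A" "{n1, n2, n3} \<subseteq> N" for i1 i2 i3 n1 n2 n3
  proof -
    have "(\<lambda>T. mon {#} T * minor i1 i2 i3 n1 n2 n3 T) \<in> minor_ideal"
      by (rule minor_ideal_base) (use that in auto)
    then show ?thesis by simp
  qed
  have "Pol N d \<subseteq> fn.span (minor_ideal \<union> mon ` std_monomials d)"
    unfolding Pol_def
  proof (rule fn.span_minimal)
    show "{mon m | m. size m = d \<and> set_mset m \<subseteq> N} \<subseteq> fn.span (minor_ideal \<union> mon ` std_monomials d)"
      using straighten[OF sub minor_ideal_mult minor] by blast
  qed simp
  then obtain x y where xy: "x \<in> minor_ideal" "y \<in> fn.span (mon ` std_monomials d)" "f = x + y"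
    using f unfolding vanishing_def fn.span_Un by (auto simp: fn.span_eq_iff[THEN iffD2, OF sub])
  have "y = 0"
    using xy(2)
  proof (rule span_image_finite[OF finite_std_monomials])
    fix \<gamma> assume y: "\<And>T. y T = (\<Sum>m\<in>std_monomials d. \<gamma> m * mon m T)"
    have "\<gamma> m = 0" if "m \<in> std_monomials d" for m
    proof (rule standard_independent[OF _ that])
      fix s y' t z :: "nat \<Rightarrow> complex"
      let ?T = "\<lambda>n. s (r (\<rho> n)) * y' (c n) + t (r (\<rho> n)) * z (c n)"
      have "?T \<in> rank_two"
        unfolding rank_two_def
        by (intro CollectI exI[of _ "\<lambda>i. s (r i)"] exI[of _ "\<lambda>i. t (r i)"]
            exI[of _ "\<lambda>n. y' (c n)"] exI[of _ "\<lambda>n. z (c n)"]) (simp add: c_upd)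
      then have "x ?T = 0" "f ?T = 0"
        using minor_ideal_rank_two[OF xy(1)] f by (auto simp: vanishing_def)
      then show "(\<Sum>m\<in>std_monomials d. \<gamma> m * mon m ?T) = 0"
        using xy(3) by (simp flip: y)
    qed
    then show "y = 0" by (simp add: y fun_eq_iff)
  qed
  then show "f \<in> minor_ideal" using xy by simp
qed

text \<open>It suffices that every member of \<open>rank_two\<close> agrees on \<open>N\<close> with
  a matrix multiplied by some \<open>g\<close> of rank at most two.\<close>

lemma vanishing_act_subset_minor_ideal:
  "vanishing N d {act g T | g T. g \<in> rank_two_matrices} \<subseteq> minor_ideal"
proof -
  have "f T = 0" if f: "f \<in> vanishing N d {act g T | g T. g \<in> rank_two_matrices}" and "T \<in> rank_two" for f T
  proof -
    have act: "f (act (\<lambda>i j. s i * y j + t i * z j) T) = 0" for T s t y z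
      using f unfolding vanishing_def rank_two_matrices_def by blast
    obtain s t y z where T: "T = (\<lambda>n. s (\<rho> n) * y n + t (\<rho> n) * z n)"
      and inv: "\<And>i n. y (upd i n) = y n" "\<And>i n. z (upd i n) = z n"
      using \<open>T \<in> rank_two\<close> unfolding rank_two_def by blast
    show ?thesis
    proof (cases "\<exists>a\<in>A. \<exists>b\<in>A. a \<noteq> b")
      case True
      then obtain a b where ab: "a \<in> A" "b \<in> A" "a \<noteq> b" by blast
      \<comment> \<open>The witness is the matrix with \<open>y\<close> in row \<open>a\<close> and
        \<open>z\<close> in all other rows; \<open>g\<close> has column \<open>s\<close> at
        \<open>a\<close>, column \<open>t\<close> at \<open>b\<close> and zeros elsewhere.\<close>
      have "(\<Sum>i\<in>A. (s (\<rho> n) * of_bool (i = a) + t (\<rho> n) * of_bool (i = b)) * (if i = a then y n else z n)) = T n" for n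
      proof -
        have "(\<Sum>i\<in>A. (s (\<rho> n) * of_bool (i = a) + t (\<rho> n) * of_bool (i = b)) * (if i = a then y n else z n))
          = (\<Sum>i\<in>A. (if i = a then s (\<rho> n) * y n else 0) + (if i = b then t (\<rho> n) * z n else 0))"
          by (rule sum.cong) (use ab in auto)
        also have "\<dots> = T n" using ab finite_A by (simp add: sum.distrib T)
        finally show ?thesis .
      qed
      then have "act (\<lambda>i j. s i * of_bool (j = a) + t i * of_bool (j = b))
          (\<lambda>n. if \<rho> n = a then y n else z n) = T"
        by (simp add: act_def inv fun_eq_iff cong: if_cong)
      then show ?thesis
        using act[of s "\<lambda>j. of_bool (j = a)" t "\<lambda>j. of_bool (j = b)" "\<lambda>n. if \<rho> n = a then y n else z n"]
        by (simp only:)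
    next
      case False
      \<comment> \<open>With at most one row, the matrix of ones acts as the identity on the entries
        in \<open>N\<close>.\<close>
      have "act (\<lambda>i j. 1 * 1 + 0 * 0) T n = T n" if "n \<in> N" for n
      proof -
        have A: "A = {\<rho> n}" using False row_in[OF that] by auto
        show ?thesis unfolding act_def unfolding A by simp
      qed
      then have "f T = f (act (\<lambda>i j. 1 * 1 + 0 * 0) T)"
        using f Pol_cong[of f N d T "act (\<lambda>i j. 1 * 1 + 0 * 0) T"] by (auto simp: vanishing_def)
      then show ?thesis using act[of "\<lambda>_. 1" "\<lambda>_. 1" "\<lambda>_. 0" "\<lambda>_. 0" T] by simp
    qed
  qed
  then have "vanishing N d {act g T | g T. g \<in> rank_two_matrices} \<subseteq> vanishing N d rank_two"
    unfolding vanishing_def by blast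
  then show ?thesis using vanishing_rank_two_subset_minor_ideal by blast
qed

end

subsection \<open>Tensors with three factors\<close>

lemma singular_2x2_product:
  fixes a b c d :: complex
  assumes "a * d = b * c"
  obtains Y Z where "\<And>j k. h0 j * (a * k0 k + b * k1 k) + h1 j * (c * k0 k + d * k1 k) = Y j * Z k"
proof (cases "a = 0")
  case False
  then have d: "d = b * c / a" using assms by (simp add: field_simps)
  show ?thesis
    by (rule that[of "\<lambda>j. h0 j + c / a * h1 j" "\<lambda>k. a * k0 k + b * k1 k"])
      (use False in \<open>simp add: d field_simps\<close>)
next
  case True
  show ?thesis
  proof (cases "b = 0")
    case b: True
    show ?thesis by (rule that[of h1 "\<lambda>k. c * k0 k + d * k1 k"]) (simp add: True b)
  next
    case False
    then have "c = 0" using True assms by simp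
    then show ?thesis
      by (intro that[of "\<lambda>j. b * h0 j + d * h1 j" k1]) (simp add: True algebra_simps)
  qed
qed

text \<open>The image of the 2x2x2 tensor with slices \<open>(a, b; c, d)\<close> and
  \<open>(a', b'; c', d')\<close> under the linear maps with columns \<open>s0, s1\<close>,
  \<open>h0, h1\<close> and \<open>k0, k1\<close>.\<close>

definition tensor_222 ::
  "('a \<Rightarrow> complex) \<Rightarrow> ('a \<Rightarrow> complex) \<Rightarrow> ('b \<Rightarrow> complex) \<Rightarrow> ('b \<Rightarrow> complex) \<Rightarrow> ('c \<Rightarrow> complex) \<Rightarrow> ('c \<Rightarrow> complex)
    \<Rightarrow> complex \<Rightarrow> complex \<Rightarrow> complex \<Rightarrow> complex \<Rightarrow> complex \<Rightarrow> complex \<Rightarrow> complex \<Rightarrow> complex \<Rightarrow> 'a \<times> 'b \<times> 'c \<Rightarrow> complex"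
  where "tensor_222 s0 s1 h0 h1 k0 k1 a b c d a' b' c' d' = (\<lambda>(i, j, k).
    s0 i * (h0 j * (a * k0 k + b * k1 k) + h1 j * (c * k0 k + d * k1 k)) +
    s1 i * (h0 j * (a' * k0 k + b' * k1 k) + h1 j * (c' * k0 k + d' * k1 k)))"

definition rank_two_tensors :: "('a \<times> 'b \<times> 'c \<Rightarrow> complex) set"
  where "rank_two_tensors = {\<lambda>(i, j, k). S i * Y j * Z k + S' i * Y' j * Z' k | S Y Z S' Y' Z'. True}"

text \<open>Let M and N be the two slices. Both N - l1 M and N - l2 M are singular, hence products,
  and (l2 - l1)(s0 M + s1 N) = (s0 + l2 s1)(N - l1 M) - (s0 + l1 s1)(N - l2 M).\<close>

lemma tensor_222_generic:
  assumes "l1 \<noteq> l2"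
    and l1: "(a' - l1 * a) * (d' - l1 * d) = (b' - l1 * b) * (c' - l1 * c)"
    and l2: "(a' - l2 * a) * (d' - l2 * d) = (b' - l2 * b) * (c' - l2 * c)"
  shows "tensor_222 s0 s1 h0 h1 k0 k1 a b c d a' b' c' d' \<in> rank_two_tensors"
proof -
  obtain Y1 Z1 where 1: "\<And>j k. h0 j * ((a' - l1 * a) * k0 k + (b' - l1 * b) * k1 k)
      + h1 j * ((c' - l1 * c) * k0 k + (d' - l1 * d) * k1 k) = Y1 j * Z1 k"
    using singular_2x2_product[OF l1] by metis
  obtain Y2 Z2 where 2: "\<And>j k. h0 j * ((a' - l2 * a) * k0 k + (b' - l2 * b) * k1 k)
      + h1 j * ((c' - l2 * c) * k0 k + (d' - l2 * d) * k1 k) = Y2 j * Z2 k"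
    using singular_2x2_product[OF l2] by metis
  have "tensor_222 s0 s1 h0 h1 k0 k1 a b c d a' b' c' d' =
    (\<lambda>(i, j, k). (s0 i + l2 * s1 i) / (l2 - l1) * Y1 j * Z1 k + (- (s0 i + l1 * s1 i) / (l2 - l1)) * Y2 j * Z2 k)"
  proof (rule ext, clarify)
    fix i j k
    let ?M = "h0 j * (a * k0 k + b * k1 k) + h1 j * (c * k0 k + d * k1 k)"
    let ?N = "h0 j * (a' * k0 k + b' * k1 k) + h1 j * (c' * k0 k + d' * k1 k)"
    have ident: "(x + l2 * y) * (n - l1 * m) - (x + l1 * y) * (n - l2 * m) = (l2 - l1) * (x * m + y * n)"
      for x y m n by (simp add: algebra_simps)
    have y1: "Y1 j * Z1 k = ?N - l1 * ?M" by (simp add: 1[symmetric] algebra_simps)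
    have y2: "Y2 j * Z2 k = ?N - l2 * ?M" by (simp add: 2[symmetric] algebra_simps)
    have "(s0 i + l2 * s1 i) / (l2 - l1) * Y1 j * Z1 k + (- (s0 i + l1 * s1 i) / (l2 - l1)) * Y2 j * Z2 k
      = ((s0 i + l2 * s1 i) * (Y1 j * Z1 k) - (s0 i + l1 * s1 i) * (Y2 j * Z2 k)) / (l2 - l1)"
      by (simp add: field_simps add_divide_distrib diff_divide_distrib)
    also have "\<dots> = ((l2 - l1) * (s0 i * ?M + s1 i * ?N)) / (l2 - l1)"
      unfolding y1 y2 ident ..
    also have "\<dots> = s0 i * ?M + s1 i * ?N" using assms(1) by simp
    finally show "tensor_222 s0 s1 h0 h1 k0 k1 a b c d a' b' c' d' (i, j, k) =
      (s0 i + l2 * s1 i) / (l2 - l1) * Y1 j * Z1 k + (- (s0 i + l1 * s1 i) / (l2 - l1)) * Y2 j * Z2 k"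
      by (simp add: tensor_222_def)
  qed
  then show ?thesis unfolding rank_two_tensors_def
    by (intro CollectI exI[of _ "\<lambda>i. (s0 i + l2 * s1 i) / (l2 - l1)"] exI[of _ Y1] exI[of _ Z1]
      exI[of _ "\<lambda>i. - (s0 i + l1 * s1 i) / (l2 - l1)"] exI[of _ Y2] exI[of _ Z2] conjI TrueI)
qed

text \<open>A density argument. For slices M and N the determinant of N - l M is quadratic in
  \<open>l\<close>; where its leading coefficient and discriminant are nonzero, it has two roots and
  \<open>tensor_222_generic\<close> applies. A line through the given tensor on which neither
  vanishes identically gives the general case.\<close>

lemma Pol_vanishes_tensor_222:
  assumes P: "P \<in> Pol N d" and zero: "\<And>T. T \<in> rank_two_tensors \<Longrightarrow> P T = 0"
  shows "P (tensor_222 s0 s1 h0 h1 k0 k1 m00 m01 m10 m11 n00 n01 n10 n11) = 0"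
proof -
  let ?t = "tensor_222 s0 s1 h0 h1 k0 k1"
  have roots: "P (?t a b c d a' b' c' d') = 0"
    if \<alpha>: "a * d - b * c \<noteq> 0" and disc: "(a * d' + d * a' - b * c' - c * b')\<^sup>2 - 4 * (a * d - b * c) * (a' * d' - b' * c') \<noteq> 0"
    for a b c d a' b' c' d'
  proof -
    \<comment> \<open>The determinant of N - l M is
      \<open>\<alpha> * l\<^sup>2 - \<beta> * l + \<gamma>\<close>.\<close>
    define \<alpha> \<beta> \<gamma> where "\<alpha> = a * d - b * c" and "\<beta> = a * d' + d * a' - b * c' - c * b'" and "\<gamma> = a' * d' - b' * c'"
    define w where "w = csqrt (\<beta>\<^sup>2 - 4 * \<alpha> * \<gamma>)"
    have w: "w\<^sup>2 = \<beta>\<^sup>2 - 4 * \<alpha> * \<gamma>" by (simp add: w_def)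
    have "w \<noteq> 0" using disc w by (auto simp: \<alpha>_def \<beta>_def \<gamma>_def)
    have "\<alpha> \<noteq> 0" using \<alpha> by (simp add: \<alpha>_def)
    have root: "(a' - l * a) * (d' - l * d) = (b' - l * b) * (c' - l * c)"
      if "2 * \<alpha> * l = \<beta> + v" "v\<^sup>2 = \<beta>\<^sup>2 - 4 * \<alpha> * \<gamma>" for l v
    proof -
      have "4 * \<alpha> * (\<alpha> * l\<^sup>2 - \<beta> * l + \<gamma>) = (2 * \<alpha> * l - \<beta>)\<^sup>2 - (\<beta>\<^sup>2 - 4 * \<alpha> * \<gamma>)"
        by (simp add: algebra_simps power2_eq_square)
      also have "\<dots> = 0" using that by simp
      finally have "\<alpha> * l\<^sup>2 - \<beta> * l + \<gamma> = 0" using \<open>\<alpha> \<noteq> 0\<close> by simp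
      moreover have "(a' - l * a) * (d' - l * d) - (b' - l * b) * (c' - l * c) = \<alpha> * l\<^sup>2 - \<beta> * l + \<gamma>"
        by (simp add: \<alpha>_def \<beta>_def \<gamma>_def algebra_simps power2_eq_square)
      ultimately show ?thesis by simp
    qed
    show ?thesis
    proof (rule zero[OF tensor_222_generic])
      show "(\<beta> + w) / (2 * \<alpha>) \<noteq> (\<beta> + - w) / (2 * \<alpha>)" using \<open>w \<noteq> 0\<close> \<open>\<alpha> \<noteq> 0\<close> by simp
      show "(a' - (\<beta> + w) / (2 * \<alpha>) * a) * (d' - (\<beta> + w) / (2 * \<alpha>) * d) =
        (b' - (\<beta> + w) / (2 * \<alpha>) * b) * (c' - (\<beta> + w) / (2 * \<alpha>) * c)"
        by (rule root[of _ w]) (use \<open>\<alpha> \<noteq> 0\<close> w in simp_all)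
      show "(a' - (\<beta> + - w) / (2 * \<alpha>) * a) * (d' - (\<beta> + - w) / (2 * \<alpha>) * d) =
        (b' - (\<beta> + - w) / (2 * \<alpha>) * b) * (c' - (\<beta> + - w) / (2 * \<alpha>) * c)"
        by (rule root[of _ "- w"]) (use \<open>\<alpha> \<noteq> 0\<close> w in simp_all)
    qed
  qed
  obtain q where q: "\<And>u. P (\<lambda>n. ?t m00 m01 m10 m11 n00 n01 n10 n11 n + u * ?t 1 0 0 1 0 0 0 1 n) = poly q u"
    using Pol_line[OF P, of "?t m00 m01 m10 m11 n00 n01 n10 n11" "?t 1 0 0 1 0 0 0 1"] by blast
  \<comment> \<open>Adding \<open>u\<close> times a fixed tensor makes \<open>\<alpha>\<close> and the discriminant monic in \<open>u\<close>.\<close>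
  have line: "(\<lambda>n. ?t m00 m01 m10 m11 n00 n01 n10 n11 n + u * ?t 1 0 0 1 0 0 0 1 n)
    = ?t (m00 + u) m01 m10 (m11 + u) n00 n01 n10 (n11 + u)" for u
    by (auto simp: tensor_222_def fun_eq_iff algebra_simps)
  define \<alpha> where "\<alpha> = [:m00 * m11 - m01 * m10, m00 + m11, 1:]"
  define \<beta> where "\<beta> = [:m00 * n11 + m11 * n00 - m01 * n10 - m10 * n01, m00 + n11 + n00, 1:]"
  define \<gamma> where "\<gamma> = [:n00 * n11 - n01 * n10, n00:]"
  have "\<beta>\<^sup>2 - 4 * \<alpha> * \<gamma> \<noteq> 0"
  proof
    assume "\<beta>\<^sup>2 - 4 * \<alpha> * \<gamma> = 0"
    then have "degree (\<beta>\<^sup>2) = degree (4 * \<alpha> * \<gamma>)" by simp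
    moreover have "degree (\<beta>\<^sup>2) = 4" by (simp add: \<beta>_def degree_power_eq)
    moreover have "degree (4 * \<alpha> * \<gamma>) \<le> 3"
    proof -
      have "degree (4 * \<alpha> * \<gamma>) \<le> degree (4 :: complex poly) + degree \<alpha> + degree \<gamma>"
        by (meson add_mono_thms_linordered_semiring(3) degree_mult_le le_trans)
      moreover have "degree \<alpha> \<le> 2" "degree \<gamma> \<le> 1" by (auto simp: \<alpha>_def \<gamma>_def)
      ultimately show ?thesis by simp
    qed
    ultimately show False by simp
  qed
  moreover have "\<alpha> \<noteq> 0" by (simp add: \<alpha>_def)
  \<comment> \<open>The product vanishes at every \<open>u\<close>, while its last two factors are
    nonzero polynomials. So \<open>q\<close> is zero, in particular at \<open>u = 0\<close>.\<close>
  moreover have "q * \<alpha> * (\<beta>\<^sup>2 - 4 * \<alpha> * \<gamma>) = 0"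
  proof (rule poly_all_0_iff_0[THEN iffD1], rule allI)
    fix u
    have \<alpha>u: "poly \<alpha> u = (m00 + u) * (m11 + u) - m01 * m10"
      by (simp add: \<alpha>_def algebra_simps)
    have \<beta>u: "poly \<beta> u = (m00 + u) * (n11 + u) + (m11 + u) * n00 - m01 * n10 - m10 * n01"
      by (simp add: \<beta>_def algebra_simps)
    have \<gamma>u: "poly \<gamma> u = n00 * (n11 + u) - n01 * n10"
      by (simp add: \<gamma>_def algebra_simps)
    have "poly q u = 0" if "poly \<alpha> u \<noteq> 0" "poly (\<beta>\<^sup>2 - 4 * \<alpha> * \<gamma>) u \<noteq> 0"
      unfolding q[symmetric] line
    proof (rule roots)
      show "(m00 + u) * (m11 + u) - m01 * m10 \<noteq> 0" using that(1) \<alpha>u by simp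
      have "poly (\<beta>\<^sup>2 - 4 * \<alpha> * \<gamma>) u = (poly \<beta> u)\<^sup>2 - 4 * poly \<alpha> u * poly \<gamma> u"
        by simp
      then show "((m00 + u) * (n11 + u) + (m11 + u) * n00 - m01 * n10 - m10 * n01)\<^sup>2
        - 4 * ((m00 + u) * (m11 + u) - m01 * m10) * (n00 * (n11 + u) - n01 * n10) \<noteq> 0"
        using that(2) unfolding \<alpha>u \<beta>u \<gamma>u by simp
    qed
    then show "poly (q * \<alpha> * (\<beta>\<^sup>2 - 4 * \<alpha> * \<gamma>)) u = 0" unfolding poly_mult by auto
  qed
  ultimately have "q = 0" by simp
  then have "P (\<lambda>n. ?t m00 m01 m10 m11 n00 n01 n10 n11 n + 0 * ?t 1 0 0 1 0 0 0 1 n) = 0"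
    unfolding q by simp
  then show ?thesis by simp
qed

section \<open>The three flattenings of a tensor\<close>

locale triple_index =
  fixes A :: "'a set" and B :: "'b set" and C :: "'c set"
  assumes finite_A: "finite A" and finite_B: "finite B" and finite_C: "finite C"
begin

abbreviation N :: "('a \<times> 'b \<times> 'c) set"
  where "N \<equiv> A \<times> B \<times> C"

sublocale F1: flattening N A fst "\<lambda>i n. (i, snd n)"
  by unfold_locales (auto simp: finite_A finite_B finite_C)

sublocale F2: flattening N B "\<lambda>n. fst (snd n)" "\<lambda>j n. (fst n, j, snd (snd n))"
  by unfold_locales (auto simp: finite_A finite_B finite_C)

sublocale F3: flattening N C "\<lambda>n. snd (snd n)" "\<lambda>k n. (fst n, fst (snd n), k)"
  by unfold_locales (auto simp: finite_A finite_B finite_C)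

lemma act_commute:
  "F1.act g (F2.act h T) = F2.act h (F1.act g T)"
  "F1.act g (F3.act k T) = F3.act k (F1.act g T)"
  "F2.act h (F3.act k T) = F3.act k (F2.act h T)"
  unfolding F1.act_def F2.act_def F3.act_def
  by (rule ext, simp add: sum_distrib_left, subst sum.swap, simp add: mult.left_commute)+

lemma act_tensor_222:
  assumes "g \<in> rank_two_matrices" "h \<in> rank_two_matrices" "k \<in> rank_two_matrices"
  shows "\<exists>s0 s1 h0 h1 k0 k1 a b c d a' b' c' d'.
    F1.act g (F2.act h (F3.act k T)) = tensor_222 s0 s1 h0 h1 k0 k1 a b c d a' b' c' d'"
proof -
  obtain s0 y0 s1 y1 where g: "g = (\<lambda>i j. s0 i * y0 j + s1 i * y1 j)"
    using assms(1) by (auto simp: rank_two_matrices_def)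
  obtain h0 z0 h1 z1 where h: "h = (\<lambda>i j. h0 i * z0 j + h1 i * z1 j)"
    using assms(2) by (auto simp: rank_two_matrices_def)
  obtain k0 w0 k1 w1 where k: "k = (\<lambda>i j. k0 i * w0 j + k1 i * w1 j)"
    using assms(3) by (auto simp: rank_two_matrices_def)
  \<comment> \<open>The contractions of \<open>T\<close> with one function per factor. Eight of them
    are the entries of the 2x2x2 tensor through which the three matrices factor.\<close>
  define \<tau> where "\<tau> y z w = (\<Sum>i\<in>A. \<Sum>j\<in>B. \<Sum>l\<in>C. y i * (z j * (w l * T (i, j, l))))" for y z w
  have "F1.act g (F2.act h (F3.act k T)) = tensor_222 s0 s1 h0 h1 k0 k1
    (\<tau> y0 z0 w0) (\<tau> y0 z0 w1) (\<tau> y0 z1 w0) (\<tau> y0 z1 w1) (\<tau> y1 z0 w0) (\<tau> y1 z0 w1) (\<tau> y1 z1 w0) (\<tau> y1 z1 w1)"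
    unfolding F1.act_def F2.act_def F3.act_def g h k tensor_222_def \<tau>_def
    by (rule ext) (simp add: split_def sum_distrib_left sum_distrib_right sum.distrib algebra_simps)
  then show ?thesis by blast
qed

text \<open>By density such a form vanishes on all tensors obtained by applying matrices of rank at
  most two in the three factors. \<open>vanishing_triple_product\<close> then splits it into forms
  treated by one flattening each.\<close>

lemma vanishing_rank_two_tensors:
  "vanishing N d rank_two_tensors \<subseteq> fn.span (F1.minor_ideal \<union> F2.minor_ideal \<union> F3.minor_ideal)"
proof
  fix f assume f: "f \<in> vanishing N d (rank_two_tensors :: ('a \<times> 'b \<times> 'c \<Rightarrow> complex) set)"
  have "f \<in> vanishing N d {F1.act g (F2.act h (F3.act k T)) | g h k T.
    g \<in> rank_two_matrices \<and> h \<in> rank_two_matrices \<and> k \<in> rank_two_matrices}"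
    unfolding vanishing_def
  proof (intro CollectI conjI ballI)
    show P: "f \<in> Pol N d" using f by (simp add: vanishing_def)
    fix X assume "X \<in> {F1.act g (F2.act h (F3.act k T)) | g h k T.
      g \<in> rank_two_matrices \<and> h \<in> rank_two_matrices \<and> k \<in> rank_two_matrices}"
    then obtain g h k T where "X = F1.act g (F2.act h (F3.act k T))"
      "g \<in> rank_two_matrices" "h \<in> rank_two_matrices" "k \<in> rank_two_matrices" by blast
    then obtain s0 s1 h0 h1 k0 k1 a b c d a' b' c' d' where
      "X = tensor_222 s0 s1 h0 h1 k0 k1 a b c d a' b' c' d'"
      using act_tensor_222[of g h k T] by metis
    then show "f X = 0"
      using Pol_vanishes_tensor_222[OF P] f by (simp add: vanishing_def)
  qed
  then have "f \<in> fn.span (vanishing N d {F1.act g T | g T. g \<in> rank_two_matrices}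
    \<union> vanishing N d {F2.act g T | g T. g \<in> rank_two_matrices}
    \<union> vanishing N d {F3.act g T | g T. g \<in> rank_two_matrices})"
    by (intro vanishing_triple_product[where ?\<Phi>1.0 = F1.act and ?\<Phi>2.0 = F2.act and ?\<Phi>3.0 = F3.act
          and ?s1.0 = adjoint and ?s2.0 = adjoint and ?G1.0 = rank_two_matrices
          and ?G2.0 = rank_two_matrices and ?G3.0 = rank_two_matrices and f = f and N = N and d = d]
        F1.finite_N adjoint_rank_two F1.act_adjoint F2.act_adjoint act_commute)
  moreover have "fn.span (vanishing N d {F1.act g T | g T. g \<in> rank_two_matrices}
    \<union> vanishing N d {F2.act g T | g T. g \<in> rank_two_matrices}
    \<union> vanishing N d {F3.act g T | g T. g \<in> rank_two_matrices})
    \<subseteq> fn.span (F1.minor_ideal \<union> F2.minor_ideal \<union> F3.minor_ideal)"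
    by (intro fn.span_mono Un_mono F1.vanishing_act_subset_minor_ideal
        F2.vanishing_act_subset_minor_ideal F3.vanishing_act_subset_minor_ideal)
  ultimately show "f \<in> fn.span (F1.minor_ideal \<union> F2.minor_ideal \<union> F3.minor_ideal)" by blast
qed

end

subsection \<open>The ideal of the secant variety\<close>

definition sum_terms :: "(complex \<times> 'n multiset) list \<Rightarrow> ('n \<Rightarrow> complex) \<Rightarrow> complex"
  where "sum_terms L T = (\<Sum>(k, m)\<leftarrow>L. k * mon m T)"

lemma sum_terms_simps [simp]:
  "sum_terms [] T = 0" "sum_terms ((k, m) # L) T = k * mon m T + sum_terms L T"
  "sum_terms (L @ L') T = sum_terms L T + sum_terms L' T"
  by (simp_all add: sum_terms_def)

lemma sum_terms_mult:
  assumes "\<forall>(k, m)\<in>set L. set_mset m \<subseteq> N" "\<forall>(k, m)\<in>set L'. set_mset m \<subseteq> N"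
  shows "\<exists>M. (\<forall>(k, m)\<in>set M. set_mset m \<subseteq> N) \<and> (\<forall>T. sum_terms M T = sum_terms L T * sum_terms L' T)"
  using assms(1)
proof (induction L)
  case Nil
  show ?case by (intro exI[of _ "[]"]) simp
next
  case (Cons x L)
  obtain k m where x: "x = (k, m)" by fastforce
  obtain M where M: "\<forall>(k, m)\<in>set M. set_mset m \<subseteq> N" "\<And>T. sum_terms M T = sum_terms L T * sum_terms L' T"
    using Cons by auto
  have "sum_terms (map (\<lambda>(k', m'). (k * k', m + m')) L') T = k * mon m T * sum_terms L' T" for T
    by (induction L') (auto simp: algebra_simps)
  then have "sum_terms (map (\<lambda>(k', m'). (k * k', m + m')) L' @ M) T = sum_terms (x # L) T * sum_terms L' T" for T
    by (simp add: M x algebra_simps)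
  moreover have "\<forall>(k, m)\<in>set (map (\<lambda>(k', m'). (k * k', m + m')) L' @ M). set_mset m \<subseteq> N"
  proof -
    have "set_mset m \<subseteq> N" using Cons.prems x by simp
    moreover have "set_mset m' \<subseteq> N" if "(k', m') \<in> set L'" for k' m' using assms(2) that by blast
    ultimately show ?thesis using M(1) by (auto 0 0 simp: ball_Un; blast)
  qed
  ultimately show ?case by blast
qed

lemma sum_terms_Pol:
  assumes "\<forall>(k, m)\<in>set L. size m = d \<and> set_mset m \<subseteq> N"
  shows "sum_terms L \<in> Pol N d"
  using assms
proof (induction L)
  case Nil
  have "sum_terms [] = (0 :: ('a \<Rightarrow> complex) \<Rightarrow> complex)" by (simp add: fun_eq_iff)
  then show ?case by (simp only: Pol_def fn.span_zero)
next
  case (Cons x L)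
  obtain k m where x: "x = (k, m)" by fastforce
  have "mon m \<in> {mon m | m. size m = d \<and> set_mset m \<subseteq> N}" using Cons.prems x by auto
  from fn.span_add[OF fn.span_scale[OF fn.span_base[OF this], of k], of "sum_terms L"]
  show ?case using Cons x by (simp add: Pol_def plus_fun_def)
qed

lemma sum_terms_homogeneous_parts:
  assumes "\<forall>(k, m)\<in>set L. size m \<le> D"
  shows "sum_terms L T = (\<Sum>d\<le>D. sum_terms (filter (\<lambda>(k, m). size m = d) L) T)"
  using assms
proof (induction L)
  case (Cons x L)
  obtain k m where x: "x = (k, m)" by fastforce
  have "(\<Sum>d\<le>D. sum_terms (filter (\<lambda>(k, m). size m = d) (x # L)) T)
    = (\<Sum>d\<le>D. (if d = size m then k * mon m T else 0) + sum_terms (filter (\<lambda>(k, m). size m = d) L) T)"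
    by (rule sum.cong) (auto simp: x)
  also have "\<dots> = k * mon m T + sum_terms L T"
    using Cons by (simp add: sum.distrib x)
  finally show ?case by (simp add: x)
qed simp

lemma vector_space_scalars: "vector_space ((*) :: complex \<Rightarrow> complex \<Rightarrow> complex)"
  by unfold_locales (auto simp: algebra_simps)

text \<open>Linear forms separate points, which turns uniqueness in the universal property into a
  spanning statement.\<close>

lemma exists_linear_form:
  assumes "vector_space s" "v \<noteq> 0"
  shows "\<exists>l. Vector_Spaces.linear s (*) l \<and> l v = (1::complex)"
proof -
  interpret V: vector_space s by fact
  interpret C: vector_space "(*) :: complex \<Rightarrow> complex \<Rightarrow> complex"
    by (rule vector_space_scalars)
  interpret vector_space_pair s "(*) :: complex \<Rightarrow> complex \<Rightarrow> complex" ..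
  have "V.independent {v}" using assms(2) by (simp add: V.dependent_single)
  from linear_independent_extend[OF this, of "\<lambda>_. 1"] show ?thesis by auto
qed

section \<open>Coordinates on the tensor product\<close>

locale segre_tensor =
  VA: finite_dimensional_vector_space sA basisA +
  VB: finite_dimensional_vector_space sB basisB +
  VC: finite_dimensional_vector_space sC basisC
  for sA :: "complex \<Rightarrow> 'a::ab_group_add \<Rightarrow> 'a" and basisA
    and sB :: "complex \<Rightarrow> 'b::ab_group_add \<Rightarrow> 'b" and basisB
    and sC :: "complex \<Rightarrow> 'c::ab_group_add \<Rightarrow> 'c" and basisC +
  fixes sV :: "complex \<Rightarrow> 'v::ab_group_add \<Rightarrow> 'v" and t :: "'a \<Rightarrow> 'b \<Rightarrow> 'c \<Rightarrow> 'v"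
  assumes tensor: "is_tensor_product sA sB sC sV t"
begin

sublocale V: vector_space sV
  using tensor by (simp add: is_tensor_product_def)

sublocale triple_index basisA basisB basisC
  by unfold_locales (simp_all add: VA.finite_Basis VB.finite_Basis VC.finite_Basis)

lemma linear_iff:
  "Vector_Spaces.linear sV (*) l \<longleftrightarrow> (\<forall>v w. l (v + w) = l v + l w) \<and> (\<forall>k v. l (sV k v) = k * l v)"
  using V.vector_space_axioms vector_space_scalars
  by (auto simp: Vector_Spaces.linear_iff)

lemma
  shows t_add1: "t (a + a') b c = t a b c + t a' b c"
    and t_add2: "t a (b + b') c = t a b c + t a b' c"
    and t_add3: "t a b (c + c') = t a b c + t a b c'"
    and t_scale1: "t (sA k a) b c = sV k (t a b c)"
    and t_scale2: "t a (sB k b) c = sV k (t a b c)"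
    and t_scale3: "t a b (sC k c) = sV k (t a b c)"
  using tensor by (auto simp: is_tensor_product_def trilinear_def Vector_Spaces.linear_iff)

lemma
  shows t_zero1 [simp]: "t 0 b c = 0" and t_zero2 [simp]: "t a 0 c = 0" and t_zero3 [simp]: "t a b 0 = 0"
  using t_add1[of 0 0] t_add2[of _ 0 0] t_add3[of _ _ 0 0] by simp_all

definition coordA :: "'a \<Rightarrow> 'a \<Rightarrow> complex" where "coordA = VA.representation basisA"
definition coordB :: "'b \<Rightarrow> 'b \<Rightarrow> complex" where "coordB = VB.representation basisB"
definition coordC :: "'c \<Rightarrow> 'c \<Rightarrow> complex" where "coordC = VC.representation basisC"

lemma coord_linear:
  "coordA (a + a') i = coordA a i + coordA a' i" "coordA (sA k a) i = k * coordA a i"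
  "coordB (b + b') j = coordB b j + coordB b' j" "coordB (sB k b) j = k * coordB b j"
  "coordC (c + c') l = coordC c l + coordC c' l" "coordC (sC k c) l = k * coordC c l"
  unfolding coordA_def coordB_def coordC_def
  by (simp_all add: VA.representation_add VA.representation_scale VB.representation_add
      VB.representation_scale VC.representation_add VC.representation_scale
      VA.independent_Basis VA.span_Basis VB.independent_Basis VB.span_Basis VC.independent_Basis VC.span_Basis)

lemma sum_coord:
  "(\<Sum>i\<in>basisA. sA (coordA a i) i) = a"
  "(\<Sum>j\<in>basisB. sB (coordB b j) j) = b"
  "(\<Sum>l\<in>basisC. sC (coordC c l) l) = c"
  unfolding coordA_def coordB_def coordC_def
  by (simp_all add: VA.sum_representation_eq VB.sum_representation_eq VC.sum_representation_eq
      VA.independent_Basis VA.span_Basis VB.independent_Basis VB.span_Basis VC.independent_Basis VC.span_Basis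
      VA.finite_Basis VB.finite_Basis VC.finite_Basis)

lemma coord_sum:
  "i \<in> basisA \<Longrightarrow> coordA (\<Sum>i\<in>basisA. sA (S i) i) i = S i"
  "j \<in> basisB \<Longrightarrow> coordB (\<Sum>j\<in>basisB. sB (Y j) j) j = Y j"
  "l \<in> basisC \<Longrightarrow> coordC (\<Sum>l\<in>basisC. sC (Z l) l) l = Z l"
  unfolding coordA_def coordB_def coordC_def
  by (simp_all add: VA.representation_sum VB.representation_sum VC.representation_sum
      VA.representation_scale VB.representation_scale VC.representation_scale
      VA.representation_basis VB.representation_basis VC.representation_basis
      VA.independent_Basis VA.span_Basis VB.independent_Basis VB.span_Basis VC.independent_Basis VC.span_Basis
      VA.finite_Basis VB.finite_Basis VC.finite_Basis if_distrib cong: if_cong)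

lemma universal:
  "trilinear sA sB sC (*) f \<Longrightarrow>
    \<exists>!g. Vector_Spaces.linear sV (*) g \<and> (\<forall>a b c. g (t a b c) = f a b c)"
  using tensor by (simp add: is_tensor_product_def)

lemma trilinearI:
  fixes f :: "'a \<Rightarrow> 'b \<Rightarrow> 'c \<Rightarrow> complex"
  assumes "\<And>a a' b c. f (a + a') b c = f a b c + f a' b c"
    and "\<And>a b b' c. f a (b + b') c = f a b c + f a b' c"
    and "\<And>a b c c'. f a b (c + c') = f a b c + f a b c'"
    and "\<And>k a b c. f (sA k a) b c = k * f a b c"
    and "\<And>k a b c. f a (sB k b) c = k * f a b c"
    and "\<And>k a b c. f a b (sC k c) = k * f a b c"
  shows "trilinear sA sB sC (*) f"
  unfolding trilinear_def Vector_Spaces.linear_iff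
  by (intro conjI allI VA.vector_space_axioms VB.vector_space_axioms VC.vector_space_axioms
      vector_space_scalars assms)

lemma exists_coordinate:
  "\<exists>g. Vector_Spaces.linear sV (*) g \<and>
    (\<forall>a b c. g (t a b c) = coordA a (fst n) * coordB b (fst (snd n)) * coordC c (snd (snd n)))"
proof -
  have "trilinear sA sB sC (*) (\<lambda>a b c. coordA a (fst n) * coordB b (fst (snd n)) * coordC c (snd (snd n)))"
    by (rule trilinearI) (simp_all add: coord_linear ring_distribs)
  from universal[OF this] show ?thesis by (rule ex1_implies_ex)
qed

text \<open>The coordinate functions come from the universal property, applied to products of
  coordinates on the three factors.\<close>

definition coord :: "'v \<Rightarrow> 'a \<times> 'b \<times> 'c \<Rightarrow> complex"
  where "coord v n = (SOME g. Vector_Spaces.linear sV (*) g \<and>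
    (\<forall>a b c. g (t a b c) = coordA a (fst n) * coordB b (fst (snd n)) * coordC c (snd (snd n)))) v"

lemma linear_coord: "Vector_Spaces.linear sV (*) (\<lambda>v. coord v n)"
  and coord_t: "coord (t a b c) n = coordA a (fst n) * coordB b (fst (snd n)) * coordC c (snd (snd n))"
  using someI_ex[OF exists_coordinate[of n]] unfolding coord_def by simp_all

lemma coord_add: "coord (v + w) n = coord v n + coord w n"
  and coord_scale: "coord (sV k v) n = k * coord v n"
  using linear_coord[of n] by (auto simp: linear_iff)

text \<open>Otherwise some linear form \<open>l\<close> is 1 on the difference of \<open>v\<close>
  and its expansion. Composed with the difference map, \<open>l\<close> is linear and zero on all
  decomposable tensors, so by uniqueness in the universal property it is zero.\<close>

lemma sum_coord_tensor:
  "(\<Sum>(i, j, k)\<in>basisA \<times> basisB \<times> basisC. sV (coord v (i, j, k)) (t i j k)) = v" (is "?\<pi> v = v")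
proof (rule ccontr)
  assume "?\<pi> v \<noteq> v"
  then have "v - ?\<pi> v \<noteq> 0" unfolding right_minus_eq by (rule not_sym)
  then obtain l where l: "Vector_Spaces.linear sV (*) l" "l (v - ?\<pi> v) = 1"
    using exists_linear_form[OF V.vector_space_axioms] by blast
  have t_sum1: "t (\<Sum>i\<in>I. f i) b c = (\<Sum>i\<in>I. t (f i) b c)" for f :: "'a \<Rightarrow> 'a" and I b c
    by (induction I rule: infinite_finite_induct) (auto simp: t_add1)
  have t_sum2: "t a (\<Sum>i\<in>I. f i) c = (\<Sum>i\<in>I. t a (f i) c)" for f :: "'b \<Rightarrow> 'b" and I a c
    by (induction I rule: infinite_finite_induct) (auto simp: t_add2)
  have t_sum3: "t a b (\<Sum>i\<in>I. f i) = (\<Sum>i\<in>I. t a b (f i))" for f :: "'c \<Rightarrow> 'c" and I a b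
    by (induction I rule: infinite_finite_induct) (auto simp: t_add3)
  have \<pi>_t: "?\<pi> (t a b c) = t a b c" for a b c
  proof -
    have "t a b c = t (\<Sum>i\<in>basisA. sA (coordA a i) i) (\<Sum>j\<in>basisB. sB (coordB b j) j) (\<Sum>l\<in>basisC. sC (coordC c l) l)"
      by (simp only: sum_coord)
    also have "\<dots> = (\<Sum>i\<in>basisA. \<Sum>j\<in>basisB. \<Sum>l\<in>basisC. sV (coordA a i * coordB b j * coordC c l) (t i j l))"
      by (simp only: t_sum1, simp only: t_sum2, simp only: t_sum3 t_scale1 t_scale2 t_scale3 V.scale_scale mult_ac)
    also have "\<dots> = ?\<pi> (t a b c)"
      by (simp add: coord_t sum.cartesian_product split_def)
    finally show ?thesis by simp
  qed
  have \<pi>_add: "?\<pi> (v + w) = ?\<pi> v + ?\<pi> w" for v w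
    by (simp add: coord_add V.scale_left_distrib split_def sum.distrib)
  have \<pi>_scale: "?\<pi> (sV k v) = sV k (?\<pi> v)" for k v
    by (simp add: coord_scale V.scale_sum_right split_def)
  have l_add: "l (v + w) = l v + l w" and l_scale: "l (sV k v) = k * l v" for v w k
    using l(1) by (auto simp: linear_iff)
  have l_diff: "l (v - w) = l v - l w" for v w using l_add[of "v - w" w] by simp
  have 1: "Vector_Spaces.linear sV (*) (\<lambda>v. l (v - ?\<pi> v))"
    by (simp only: linear_iff l_diff l_add l_scale \<pi>_add \<pi>_scale) (simp add: algebra_simps)
  have 2: "Vector_Spaces.linear sV (*) (\<lambda>v. 0)"
    by (simp add: linear_iff)
  have "trilinear sA sB sC (*) (\<lambda>a b c. 0)"
    by (rule trilinearI) simp_all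
  from universal[OF this]
  have "\<exists>!g. Vector_Spaces.linear sV (*) g \<and> (\<forall>a b c. g (t a b c) = 0)" .
  moreover have "\<forall>a b c. l (t a b c - ?\<pi> (t a b c)) = 0"
    unfolding \<pi>_t using l_diff[of 0 0] by simp
  ultimately have "(\<lambda>v. l (v - ?\<pi> v)) = (\<lambda>v. 0)" using 1 2 by blast
  then show False using l(2) by (metis one_neq_zero)
qed

lemma polynomials_sum_terms:
  assumes "p \<in> polynomials sV"
  shows "\<exists>L. (\<forall>(k, m)\<in>set L. set_mset m \<subseteq> N) \<and> (\<forall>v. p v = sum_terms L (coord v))"
  using assms
proof (induction rule: polynomials.induct)
  case (const k)
  show ?case by (intro exI[of _ "[(k, {#})]"]) simp
next
  case (linear l)
  have l_add: "l (v + w) = l v + l w" and l_scale: "l (sV k v) = k * l v" for v w k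
    using linear by (auto simp: linear_iff)
  have l_sum: "l (\<Sum>i\<in>I. f i) = (\<Sum>i\<in>I. l (f i))" for f :: "'a \<times> 'b \<times> 'c \<Rightarrow> 'v" and I
    using l_add[of 0 0] by (induction I rule: infinite_finite_induct) (auto simp: l_add)
  obtain ns where ns: "set ns = N" "distinct ns" using finite_distinct_list[OF F1.finite_N] by blast
  \<comment> \<open>The coefficients of a linear form are its values on the tensors of basis
    vectors.\<close>
  have l_eq: "l v = sum_terms (map (\<lambda>(i, j, k). (l (t i j k), {#(i, j, k)#})) ns) (coord v)" for v
  proof -
    have "l v = l (\<Sum>(i, j, k)\<in>N. sV (coord v (i, j, k)) (t i j k))" by (simp only: sum_coord_tensor)
    also have "\<dots> = (\<Sum>n\<in>set ns. l (t (fst n) (fst (snd n)) (snd (snd n))) * coord v n)"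
      by (simp add: l_sum l_scale split_def ns(1) mult.commute)
    also have "\<dots> = sum_terms (map (\<lambda>(i, j, k). (l (t i j k), {#(i, j, k)#})) ns) (coord v)"
      using ns(2) by (simp add: sum.distinct_set_conv_list sum_terms_def comp_def split_def)
    finally show ?thesis .
  qed
  show ?case
  proof (intro exI conjI allI)
    show "\<forall>(k, m)\<in>set (map (\<lambda>(i, j, k). (l (t i j k), {#(i, j, k)#})) ns). set_mset m \<subseteq> N"
      using ns(1) by auto
  qed (rule l_eq)
next
  case (add p q)
  then obtain L L' where "\<forall>(k, m)\<in>set L. set_mset m \<subseteq> N" "\<forall>v. p v = sum_terms L (coord v)"
    "\<forall>(k, m)\<in>set L'. set_mset m \<subseteq> N" "\<forall>v. q v = sum_terms L' (coord v)" by blast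
  then show ?case by (intro exI[of _ "L @ L'"]) auto
next
  case (mult p q)
  then obtain L L' where L: "\<forall>(k, m)\<in>set L. set_mset m \<subseteq> N" "\<forall>v. p v = sum_terms L (coord v)"
    "\<forall>(k, m)\<in>set L'. set_mset m \<subseteq> N" "\<forall>v. q v = sum_terms L' (coord v)" by blast
  obtain M where "\<forall>(k, m)\<in>set M. set_mset m \<subseteq> N" "\<forall>T. sum_terms M T = sum_terms L T * sum_terms L' T"
    using sum_terms_mult[OF L(1,3)] by blast
  then show ?case using L(2,4) by (intro exI[of _ M]) simp
qed

lemma polynomials_homogeneous_parts:
  assumes "p \<in> polynomials sV"
  obtains F D where "\<And>d. F d \<in> Pol N d" "\<And>v. p v = (\<Sum>d\<le>D. F d (coord v))"
proof -
  obtain L where L: "\<forall>(k, m)\<in>set L. set_mset m \<subseteq> N" "\<forall>v. p v = sum_terms L (coord v)"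
    using polynomials_sum_terms[OF assms] by blast
  define D where "D = Max (insert 0 ((\<lambda>(k, m). size m) ` set L))"
  have "\<forall>(k, m)\<in>set L. size m \<le> D" unfolding D_def by (auto intro!: Max_ge image_eqI)
  then have "p v = (\<Sum>d\<le>D. sum_terms (filter (\<lambda>(k, m). size m = d) L) (coord v))" for v
    using L(2) sum_terms_homogeneous_parts by metis
  moreover have "sum_terms (filter (\<lambda>(k, m). size m = d) L) \<in> Pol N d" for d
    by (rule sum_terms_Pol) (use L(1) in auto)
  ultimately show ?thesis using that[of "\<lambda>d. sum_terms (filter (\<lambda>(k, m). size m = d) L)" D] by blast
qed

section \<open>Vanishing on the secant variety\<close>

abbreviation secant_ideal :: "('v \<Rightarrow> complex) set"
  where "secant_ideal \<equiv> vanishing_ideal sV (secant_variety sV (segre sV t))"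

text \<open>A nonzero sum of two nonzero decomposable tensors spans a point of the line through
  their classes. If one summand is zero, the line from a point to itself is used; the zero vector is
  covered by the origin in \<open>affine_cone\<close>.\<close>

lemma secant_ideal_vanishes:
  assumes "p \<in> secant_ideal"
  shows "p (t a b c + t a' b' c') = 0"
proof -
  have main: "p v = 0" if "x \<in> segre sV t" "y \<in> segre sV t" "v \<in> V.span (x \<union> y)" for x y v
  proof (cases "v = 0")
    case True
    then show ?thesis using assms by (simp add: vanishing_ideal_def affine_cone_def)
  next
    case False
    have "V.span {v} \<subseteq> V.span (x \<union> y)" using that(3) by (intro V.span_minimal) auto
    then have "proj_point sV v \<in> proj_line sV x y"
      using False by (auto simp: proj_line_def proj_space_def proj_point_def)
    then have "proj_point sV v \<in> secant_variety sV (segre sV t)"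
      unfolding secant_variety_def zariski_closure_def using that hull_subset by fast
    moreover have "v \<in> proj_point sV v" by (simp add: proj_point_def V.span_base)
    ultimately show ?thesis using assms by (auto simp: vanishing_ideal_def affine_cone_def)
  qed
  have pt: "proj_point sV (t a b c) \<in> segre sV t" if "t a b c \<noteq> 0" for a b c
    using that unfolding segre_def by (metis (mono_tags, lifting) mem_Collect_eq t_zero1 t_zero2 t_zero3)
  have self: "v \<in> proj_point sV v" for v by (simp add: proj_point_def V.span_base)
  consider "t a b c = 0" "t a' b' c' = 0" | "t a b c \<noteq> 0" "t a' b' c' = 0" | "t a b c = 0" "t a' b' c' \<noteq> 0"
    | "t a b c \<noteq> 0" "t a' b' c' \<noteq> 0" by blast
  then show ?thesis
  proof cases
    case 1
    then show ?thesis using assms by (simp add: vanishing_ideal_def affine_cone_def)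
  next
    case 2
    then show ?thesis using main[OF pt pt, of a b c a b c] self by (simp add: V.span_base)
  next
    case 3
    then show ?thesis using main[OF pt pt, of a' b' c' a' b' c'] self by (simp add: V.span_base)
  next
    case 4
    then show ?thesis
      using self by (intro main[OF pt pt, of a b c a' b' c'] V.span_add V.span_base) auto
  qed
qed

text \<open>The zero set of the form is closed and contains every line through two points of the
  Segre variety, hence also the closure. Scalars on the two summands are absorbed into the first
  tensor factor.\<close>

lemma form_in_secant_ideal:
  assumes p: "p \<in> forms sV d" and zero: "\<And>a b c a' b' c'. p (t a b c + t a' b' c') = 0"
  shows "p \<in> secant_ideal"
proof -
  define Z where "Z = {x \<in> proj_space sV. \<forall>v\<in>x. p v = 0}"
  have "zariski_closed sV Z"
    unfolding zariski_closed_def Z_def using p by (intro exI[of _ "{p}"]) auto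
  moreover have "proj_line sV x y \<subseteq> Z" if "x \<in> segre sV t" "y \<in> segre sV t" for x y
  proof -
    obtain a b c a' b' c' where x: "x = V.span {t a b c}" and y: "y = V.span {t a' b' c'}"
      using \<open>x \<in> segre sV t\<close> \<open>y \<in> segre sV t\<close> by (auto simp: segre_def proj_point_def)
    have "p v = 0" if "v \<in> V.span (x \<union> y)" for v
    proof -
      obtain u w where "u \<in> V.span {t a b c}" "w \<in> V.span {t a' b' c'}" "v = u + w"
        using \<open>v \<in> V.span (x \<union> y)\<close> unfolding x y V.span_Un V.span_span by blast
      then obtain k k' where "v = sV k (t a b c) + sV k' (t a' b' c')"
        by (auto simp: V.span_singleton)
      then show ?thesis using zero[of "sA k a" b c "sA k' a'" b' c'] by (simp add: t_scale1)
    qed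
    then show ?thesis unfolding proj_line_def Z_def by auto
  qed
  ultimately have "secant_variety sV (segre sV t) \<subseteq> Z"
    unfolding secant_variety_def zariski_closure_def by (intro hull_minimal) blast+
  moreover have "p 0 = 0" using zero[of 0 0 0 0 0 0] by simp
  ultimately show ?thesis
    using p by (auto simp: vanishing_ideal_def affine_cone_def Z_def forms_def)
qed

lemma ideal_secant_ideal: "ideal secant_ideal (polynomial_ring sV)"
proof -
  interpret R: cring "polynomial_ring sV" by (rule cring_polynomial_ring)
  have minus: "\<ominus>\<^bsub>polynomial_ring sV\<^esub> p = (\<lambda>v. (- 1) * p v)" if "p \<in> polynomials sV" for p
    by (rule R.minus_equality)
      (use that polynomials.mult[OF polynomials.const[of "- 1"]] in \<open>auto simp: polynomial_ring_def\<close>)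
  show ?thesis
  proof (rule idealI)
    show "ring (polynomial_ring sV)" by (rule R.ring_axioms)
    show "subgroup secant_ideal (add_monoid (polynomial_ring sV))"
    proof (rule R.add.subgroupI)
      show "secant_ideal \<subseteq> carrier (polynomial_ring sV)"
        by (auto simp: vanishing_ideal_def polynomial_ring_def)
      show "secant_ideal \<noteq> {}"
        using polynomials.const[of 0] by (auto simp: vanishing_ideal_def)
    next
      fix p assume "p \<in> secant_ideal"
      then show "\<ominus>\<^bsub>polynomial_ring sV\<^esub> p \<in> secant_ideal"
        using minus[of p] polynomials.mult[OF polynomials.const[of "- 1"], of p]
        by (auto simp: vanishing_ideal_def)
    next
      fix p q assume "p \<in> secant_ideal" "q \<in> secant_ideal"
      then show "p \<oplus>\<^bsub>polynomial_ring sV\<^esub> q \<in> secant_ideal"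
        by (auto simp: vanishing_ideal_def polynomial_ring_def intro: polynomials.add)
    qed
  qed (auto simp: vanishing_ideal_def polynomial_ring_def intro: polynomials.mult)
qed

text \<open>Any functions on the bases are the coordinates of vectors, so on \<open>N\<close> each
  member of \<open>rank_two_tensors\<close> agrees with the coordinates of a sum of two decomposable
  tensors.\<close>

lemma coord_rank_two_tensors:
  assumes "P \<in> Pol N d" "\<And>a b c a' b' c'. P (coord (t a b c + t a' b' c')) = 0"
  shows "P \<in> vanishing N d rank_two_tensors"
proof -
  have "P T = 0" if "T \<in> rank_two_tensors" for T
  proof -
    obtain S Y Z S' Y' Z' where T: "T = (\<lambda>(i, j, k). S i * Y j * Z k + S' i * Y' j * Z' k)"
      using \<open>T \<in> rank_two_tensors\<close> by (auto simp: rank_two_tensors_def)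
    let ?v = "t (\<Sum>i\<in>basisA. sA (S i) i) (\<Sum>j\<in>basisB. sB (Y j) j) (\<Sum>l\<in>basisC. sC (Z l) l)
      + t (\<Sum>i\<in>basisA. sA (S' i) i) (\<Sum>j\<in>basisB. sB (Y' j) j) (\<Sum>l\<in>basisC. sC (Z' l) l)"
    have "P T = P (coord ?v)"
      by (rule Pol_cong[OF assms(1)]) (auto simp: T coord_add coord_t coord_sum)
    then show ?thesis using assms(2) by simp
  qed
  then show ?thesis using assms(1) by (simp add: vanishing_def)
qed

lemma coord_polynomial: "(\<lambda>v. coord v n) \<in> polynomials sV"
  by (rule polynomials.linear) (rule linear_coord)

lemma mon_coord_polynomial: "(\<lambda>v. mon m (coord v)) \<in> polynomials sV"
proof (induction m)
  case empty
  show ?case using polynomials.const[of 1] by simp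
next
  case (add n m)
  show ?case using polynomials.mult[OF coord_polynomial add] by simp
qed

lemma det3_form:
  "(\<lambda>v. det3 (\<lambda>i n. coord v (f i n)) i1 i2 i3 n1 n2 n3) \<in> forms sV 3"
proof -
  have mult: "(\<lambda>v. coord v a * coord v b * coord v c) \<in> polynomials sV" for a b c
    by (intro polynomials.mult coord_polynomial)
  have diff: "(\<lambda>v. p v - q v) \<in> polynomials sV" if "p \<in> polynomials sV" "q \<in> polynomials sV" for p q
    using polynomials.add[OF that(1) polynomials.mult[OF polynomials.const[of "- 1"] that(2)]] by simp
  have "(\<lambda>v. det3 (\<lambda>i n. coord v (f i n)) i1 i2 i3 n1 n2 n3) \<in> polynomials sV"
    unfolding det3_def by (intro polynomials.add diff mult)
  then show ?thesis
    by (simp add: forms_def det3_def coord_scale algebra_simps power3_eq_cube)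
qed

text \<open>Grouping the coordinates of two factors shows that a sum of two decomposable tensors has
  rank at most two in each flattening, so the minors vanish there.\<close>

lemma minor_coord:
  "(\<lambda>v. F1.minor i1 i2 i3 n1 n2 n3 (coord v)) \<in> forms sV 3 \<inter> secant_ideal"
  "(\<lambda>v. F2.minor j1 j2 j3 n1 n2 n3 (coord v)) \<in> forms sV 3 \<inter> secant_ideal"
  "(\<lambda>v. F3.minor k1 k2 k3 n1 n2 n3 (coord v)) \<in> forms sV 3 \<inter> secant_ideal"
proof -
  have coord: "coord (t a b c + t a' b' c') =
    (\<lambda>n. coordA a (fst n) * coordB b (fst (snd n)) * coordC c (snd (snd n))
      + coordA a' (fst n) * coordB b' (fst (snd n)) * coordC c' (snd (snd n)))" for a b c a' b' c'
    by (simp add: fun_eq_iff coord_add coord_t)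
  have 1: "coord (t a b c + t a' b' c') \<in> F1.rank_two" for a b c a' b' c'
    unfolding F1.rank_two_def coord
    by (intro CollectI exI[of _ "coordA a"] exI[of _ "coordA a'"]
        exI[of _ "\<lambda>n. coordB b (fst (snd n)) * coordC c (snd (snd n))"]
        exI[of _ "\<lambda>n. coordB b' (fst (snd n)) * coordC c' (snd (snd n))"]) (simp add: mult.assoc)
  have 2: "coord (t a b c + t a' b' c') \<in> F2.rank_two" for a b c a' b' c'
    unfolding F2.rank_two_def coord
    by (intro CollectI exI[of _ "coordB b"] exI[of _ "coordB b'"]
        exI[of _ "\<lambda>n. coordA a (fst n) * coordC c (snd (snd n))"]
        exI[of _ "\<lambda>n. coordA a' (fst n) * coordC c' (snd (snd n))"]) (simp add: fun_eq_iff mult_ac)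
  have 3: "coord (t a b c + t a' b' c') \<in> F3.rank_two" for a b c a' b' c'
    unfolding F3.rank_two_def coord
    by (intro CollectI exI[of _ "coordC c"] exI[of _ "coordC c'"]
        exI[of _ "\<lambda>n. coordA a (fst n) * coordB b (fst (snd n))"]
        exI[of _ "\<lambda>n. coordA a' (fst n) * coordB b' (fst (snd n))"]) (simp add: fun_eq_iff mult_ac)
  show "(\<lambda>v. F1.minor i1 i2 i3 n1 n2 n3 (coord v)) \<in> forms sV 3 \<inter> secant_ideal"
  proof
    show "(\<lambda>v. F1.minor i1 i2 i3 n1 n2 n3 (coord v)) \<in> forms sV 3"
      unfolding F1.minor_def by (rule det3_form)
    then show "(\<lambda>v. F1.minor i1 i2 i3 n1 n2 n3 (coord v)) \<in> secant_ideal"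
      by (rule form_in_secant_ideal) (rule F1.minor_rank_two[OF 1])
  qed
  show "(\<lambda>v. F2.minor j1 j2 j3 n1 n2 n3 (coord v)) \<in> forms sV 3 \<inter> secant_ideal"
  proof
    show "(\<lambda>v. F2.minor j1 j2 j3 n1 n2 n3 (coord v)) \<in> forms sV 3"
      unfolding F2.minor_def by (rule det3_form)
    then show "(\<lambda>v. F2.minor j1 j2 j3 n1 n2 n3 (coord v)) \<in> secant_ideal"
      by (rule form_in_secant_ideal) (rule F2.minor_rank_two[OF 2])
  qed
  show "(\<lambda>v. F3.minor k1 k2 k3 n1 n2 n3 (coord v)) \<in> forms sV 3 \<inter> secant_ideal"
  proof
    show "(\<lambda>v. F3.minor k1 k2 k3 n1 n2 n3 (coord v)) \<in> forms sV 3"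
      unfolding F3.minor_def by (rule det3_form)
    then show "(\<lambda>v. F3.minor k1 k2 k3 n1 n2 n3 (coord v)) \<in> secant_ideal"
      by (rule form_in_secant_ideal) (rule F3.minor_rank_two[OF 3])
  qed
qed

text \<open>All cubic forms of the ideal are taken as generators; they include the minors of the
  three flattenings. A member of the ideal is split into homogeneous parts, each of which vanishes
  on sums of two decomposable tensors and so lies in the span of the three ideals of minors.\<close>

lemma secant_ideal_generated:
  "secant_ideal = genideal (polynomial_ring sV) (forms sV 3 \<inter> secant_ideal)"
proof
  interpret R: cring "polynomial_ring sV" by (rule cring_polynomial_ring)
  define I where "I = genideal (polynomial_ring sV) (forms sV 3 \<inter> secant_ideal)"
  have G: "forms sV 3 \<inter> secant_ideal \<subseteq> carrier (polynomial_ring sV)"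
    by (auto simp: forms_def polynomial_ring_def)
  show "genideal (polynomial_ring sV) (forms sV 3 \<inter> secant_ideal) \<subseteq> secant_ideal"
    by (rule R.genideal_minimal[OF ideal_secant_ideal]) simp
  interpret I: ideal I "polynomial_ring sV" unfolding I_def by (rule R.genideal_ideal[OF G])
  have G_I: "forms sV 3 \<inter> secant_ideal \<subseteq> I" unfolding I_def by (rule R.genideal_self[OF G])
  have I_add: "(\<lambda>v. p v + q v) \<in> I" if "p \<in> I" "q \<in> I" for p q
    using I.a_closed[OF that] by (simp add: polynomial_ring_def)
  have I_mult: "(\<lambda>v. p v * q v) \<in> I" if "p \<in> polynomials sV" "q \<in> I" for p q
    using I.I_l_closed[OF that(2), of p] that(1) by (simp add: polynomial_ring_def)
  have I_zero: "(\<lambda>v. 0) \<in> I" using I.zero_closed by (simp add: polynomial_ring_def)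
  have I_sum: "(\<lambda>v. \<Sum>i\<in>X. f i v) \<in> I" if "finite X" "\<And>i. i \<in> X \<Longrightarrow> f i \<in> I" for f :: "nat \<Rightarrow> 'v \<Rightarrow> complex" and X
    using that by (induction X rule: finite_induct) (auto intro: I_zero I_add)
  \<comment> \<open>Membership in \<open>I\<close> is transported to coordinates, where the ideals
    of minors live.\<close>
  define K where "K = {P. (\<lambda>v. P (coord v)) \<in> I}"
  have K: "fn.subspace K"
    unfolding fn.subspace_def K_def
    using I_zero I_add I_mult[OF polynomials.const] by simp
  have "F1.minor_ideal \<subseteq> K" "F2.minor_ideal \<subseteq> K" "F3.minor_ideal \<subseteq> K"
    unfolding F1.minor_ideal_def F2.minor_ideal_def F3.minor_ideal_def
    by (rule fn.span_minimal[OF _ K];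
        use minor_coord G_I in \<open>auto simp: K_def intro!: I_mult mon_coord_polynomial\<close>)+
  then have span_K: "fn.span (F1.minor_ideal \<union> F2.minor_ideal \<union> F3.minor_ideal) \<subseteq> K"
    by (intro fn.span_minimal K) auto
  show "secant_ideal \<subseteq> genideal (polynomial_ring sV) (forms sV 3 \<inter> secant_ideal)"
  proof
    fix p assume p: "p \<in> secant_ideal"
    then have "p \<in> polynomials sV" by (simp add: vanishing_ideal_def)
    then obtain F D where F: "\<And>d. F d \<in> Pol N d" and pF: "\<And>v. p v = (\<Sum>d\<le>D. F d (coord v))"
      by (rule polynomials_homogeneous_parts) blast
    have "F d (coord (t a b c + t a' b' c')) = 0" if "d \<le> D" for d a b c a' b' c'
    proof -
      let ?v = "t a b c + t a' b' c'"
      \<comment> \<open>Scaling \<open>a\<close> and \<open>a'\<close> by \<open>k\<close> scales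
        the whole sum, so \<open>p\<close> becomes a polynomial in \<open>k\<close> whose
        coefficients are the values of the homogeneous parts. It vanishes for all
        \<open>k\<close>.\<close>
      have "(\<Sum>d\<le>D. F d (coord ?v) * k ^ d) = 0" for k
      proof -
        have "p (t (sA k a) b c + t (sA k a') b' c') = 0" using p by (rule secant_ideal_vanishes)
        moreover have "t (sA k a) b c + t (sA k a') b' c' = sV k ?v"
          by (simp add: t_scale1 V.scale_right_distrib)
        moreover have "coord (sV k ?v) = (\<lambda>n. k * coord ?v n)" by (simp add: fun_eq_iff coord_scale)
        ultimately show ?thesis using Pol_scale[OF F] by (simp add: pF mult.commute)
      qed
      then show ?thesis using polyfun_eq_0[of "\<lambda>d. F d (coord ?v)" D] that by blast
    qed
    then have "F d \<in> K" if "d \<le> D" for d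
      using coord_rank_two_tensors[OF F] vanishing_rank_two_tensors span_K that by blast
    then have "(\<lambda>v. \<Sum>d\<in>{..D}. F d (coord v)) \<in> I"
      by (intro I_sum) (auto simp: K_def)
    then show "p \<in> genideal (polynomial_ring sV) (forms sV 3 \<inter> secant_ideal)"
      by (simp add: I_def flip: pF)
  qed
qed

end

theorem theorem5p2:
  fixes sA :: "complex \<Rightarrow> 'a::ab_group_add \<Rightarrow> 'a"
    and sB :: "complex \<Rightarrow> 'b::ab_group_add \<Rightarrow> 'b"
    and sC :: "complex \<Rightarrow> 'c::ab_group_add \<Rightarrow> 'c"
    and sV :: "complex \<Rightarrow> 'v::ab_group_add \<Rightarrow> 'v"
    and t :: "'a \<Rightarrow> 'b \<Rightarrow> 'c \<Rightarrow> 'v"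
    and basisA :: "'a set" and basisB :: "'b set" and basisC :: "'c set"
  assumes "finite_dimensional_vector_space sA basisA"
    and "finite_dimensional_vector_space sB basisB"
    and "finite_dimensional_vector_space sC basisC"
    and "is_tensor_product sA sB sC sV t"
  shows "\<exists>G. G \<subseteq> forms sV 3 \<and>
    vanishing_ideal sV (secant_variety sV (segre sV t)) = genideal (polynomial_ring sV) G"
proof -
  interpret segre_tensor sA basisA sB basisB sC basisC sV t
    using assms by (simp add: segre_tensor_def segre_tensor_axioms_def)
  show ?thesis using secant_ideal_generated by blast
qed

end
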